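(* Let $V$ be a vertex operator algebra, $\nu$ an automorphism of $V$ of period $p>0$, $\omega_p\in\mathbb{C}$ a primitive $p$-th root of unity and $M$ a $\mathbb{Q}$-graded $\nu$-twisted $V$-module. For $u,v\in V$, $$x_0^{-1}\delta\Big(\frac{x_1-x_2}{x_0}\Big)X_M(u,x_1)X_M(v,x_2)-x_0^{-1}\delta\Big(\frac{x_2-x_1}{-x_0}\Big)X_M(v,x_2)X_M(u,x_1)$$ $$=\frac1p x_1^{-1}\sum_{r=0}^{p-1}\delta\Big(\omega_p^{-r}\Big(e^y\frac{x_2}{x_1}\Big)^{1/p}\Big)X_M(Y[\nu^ru,y]v,x_2),$$ where $y=\log\big(1+\frac{x_0}{x_2}\big)$.
   Context: $V=(V,Y,\mathbf 1,\omega)$ is a vertex operator algebra over $\mathbb{C}$ of central charge $c_V$; an automorphism $\nu$ of period $p$ is a linear automorphism of $V$ preserving $\omega$ and $\mathbf 1$ with $\nu Y(v,x)\nu^{-1}=Y(\nu v,x)$ and $\nu^p=1_V$. A $\mathbb{Q}$-graded $\nu$-twisted $V$-module is a $\mathbb{Q}$-graded space $M=\coprod_{n\in\mathbb{Q}}M_{(n)}$ with $M_{(n)}=0$ for $n$ sufficiently negative and $\dim M_{(n)}<\infty$, with a linear map $v\mapsto Y_M(v,x)=\sum_{n\in\frac1p\mathbb{Z}}v_n^\nu x^{-n-1}\in(\mathrm{End}\,M)[[x^{1/p},x^{-1/p}]]$ such that: $v_n^\nu w=0$ for $n$ sufficiently large ($v\in V,w\in M$); $Y_M(\mathbf 1,x)=1_M$;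 with $Y_M(\omega,x)=\sum_{n\in\mathbb{Z}}L_M(n)x^{-n-2}$, one has $[L_M(m),L_M(n)]=(m-n)L_M(m+n)+c_V\frac{m^3-m}{12}\delta_{m+n,0}1_M$, $L_M(0)$ acts on $M_{(n)}$ as $n$, and $Y_M(L(-1)u,x)=\frac{d}{dx}Y_M(u,x)$; and for $u,v\in V$ the twisted Jacobi identity $$x_0^{-1}\delta\Big(\frac{x_1-x_2}{x_0}\Big)Y_M(u,x_1)Y_M(v,x_2)-x_0^{-1}\delta\Big(\frac{x_2-x_1}{-x_0}\Big)Y_M(v,x_2)Y_M(u,x_1)=\frac1p x_2^{-1}\sum_{r=0}^{p-1}\delta\Big(\omega_p^r\Big(\frac{x_1-x_0}{x_2}\Big)^{1/p}\Big)Y_M(Y(\nu^ru,x_0)v,x_2)$$ holds, where $\delta(x)=\sum_{n\in\mathbb{Z}}x^n$. Homogeneous twisted vertex operators: $X_M(u,x)=Y_M(x^{L(0)}u,x)$. Also $Y[u,y]=Y(e^{yL(0)}u,e^y-1)$ for $u\in V$. The expressions $\log(1+x)$ and $e^y$ are defined by their series in nonnegative powers of $x$ and $y$. Binomial expressions are expanded in nonnegative integral powers of the second variable. *)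

theory Defs
  imports
    "HOL-Computational_Algebra.Formal_Laurent_Series"
    "HOL-Library.Groups_Big_Fun"
    "HOL-Library.Product_Plus"
begin

section \<open>Formal series with rational exponents\<close>

text \<open>
  A formal series in three commuting variables is the function sending an exponent vector to
  its coefficient; the variables are \<open>x\<^sub>0, x\<^sub>1, x\<^sub>2\<close>, or \<open>y, x\<^sub>1, x\<^sub>2\<close>, in this order.
  Operator-valued series are applied to a vector, so that coefficients lie in the vector space
  itself; a formal expression exists when every coefficient is a sum with finitely many nonzero
  terms (\<^const>\<open>Sum_any\<close>), and this is ensured throughout by the truncation conditions below.
\<close>

type_synonym expo = "rat \<times> rat \<times> rat"
type_synonym 'a fseries = "expo \<Rightarrow> 'a"

definition monomial :: "complex \<Rightarrow> expo \<Rightarrow> complex fseries" where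
  "monomial a d = (\<lambda>e. if e = d then a else 0)"

definition fsum :: "('i \<Rightarrow> 'a::comm_monoid_add fseries) \<Rightarrow> 'a fseries" where
  "fsum F = (\<lambda>e. Sum_any (\<lambda>i. F i e))"

definition fmult :: "(complex \<Rightarrow> 'a \<Rightarrow> 'a) \<Rightarrow> complex fseries \<Rightarrow> 'a::comm_monoid_add fseries \<Rightarrow> 'a fseries" where
  "fmult scale f g = (\<lambda>e. Sum_any (\<lambda>d. scale (f d) (g (e - d))))"

definition expo_scale :: "rat \<Rightarrow> expo \<Rightarrow> expo" where
  "expo_scale q = (\<lambda>(a, b, c). (q * a, q * b, q * c))"

text \<open>
  \<open>binomial_pow q a b \<beta>\<close> is \<open>(x\<^sup>a + \<beta> x\<^sup>b)\<^sup>q\<close> for exponent vectors \<open>a\<close>, \<open>b\<close>, expanded in nonnegative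
  integral powers of the second term.
\<close>

definition binomial_pow :: "rat \<Rightarrow> expo \<Rightarrow> expo \<Rightarrow> complex \<Rightarrow> complex fseries" where
  "binomial_pow q a b \<beta> =
     fsum (\<lambda>i::nat. monomial ((of_rat q gchoose i) * \<beta> ^ i)
                      (expo_scale (q - of_nat i) a + expo_scale (of_nat i) b))"

text \<open>
  \<open>delta_binomial \<alpha> p a b \<beta>\<close> is \<open>\<delta>(\<alpha> (x\<^sup>a + \<beta> x\<^sup>b)\<^bsup>1/p\<^esup>)\<close>, where \<open>\<delta>(z)\<close> is the sum of all integral powers of \<open>z\<close>.
\<close>

definition delta_binomial :: "complex \<Rightarrow> nat \<Rightarrow> expo \<Rightarrow> expo \<Rightarrow> complex \<Rightarrow> complex fseries" where
  "delta_binomial \<alpha> p a b \<beta> =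
     fsum (\<lambda>n::int. \<lambda>e. \<alpha> powi n * binomial_pow (of_int n / of_nat p) a b \<beta> e)"

text \<open>
  \<open>\<delta>(\<alpha> (e\<^sup>y x\<^sub>2 / x\<^sub>1)\<^bsup>1/p\<^esup>)\<close>, a series in \<open>y, x\<^sub>1, x\<^sub>2\<close>.
\<close>

definition delta_exp :: "complex \<Rightarrow> nat \<Rightarrow> complex fseries" where
  "delta_exp \<alpha> p =
     fsum (\<lambda>n::int. \<lambda>e. \<alpha> powi n *
       fsum (\<lambda>j::nat. monomial (fps_nth (fps_exp (of_int n / of_nat p)) j)
                        (of_nat j, - of_int n / of_nat p, of_int n / of_nat p)) e)"

text \<open>
  Substitution of \<open>y = log (1 + x\<^sub>0/x\<^sub>2)\<close> in a series in \<open>y, x\<^sub>1, x\<^sub>2\<close> that has only integral powers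
  of \<open>y\<close>, bounded below: \<open>x\<^sub>0\<^sup>a x\<^sub>1\<^sup>b x\<^sub>2\<^sup>c\<close> arises from the terms \<open>y\<^sup>j x\<^sub>1\<^sup>b x\<^sub>2\<^bsup>c+a\<^esup>\<close> via the coefficient of
  \<open>(x\<^sub>0/x\<^sub>2)\<^sup>a\<close> in \<open>y\<^sup>j\<close>.
\<close>

definition subst_log :: "(complex \<Rightarrow> 'a \<Rightarrow> 'a) \<Rightarrow> 'a::comm_monoid_add fseries \<Rightarrow> 'a fseries" where
  "subst_log scale f =
     (\<lambda>(a, b, c). if a \<in> \<int>
        then Sum_any (\<lambda>j::int. scale (fls_nth (fps_to_fls (fps_ln 1) powi j) \<lfloor>a\<rfloor>) (f (of_int j, b, c + a)))
        else 0)"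

section \<open>Graded spaces\<close>

locale graded_space = vector_space scale
  for scale :: "complex \<Rightarrow> 'a::ab_group_add \<Rightarrow> 'a" +
  fixes G :: "'i::linorder \<Rightarrow> 'a set"
  assumes subspace_G: "module.subspace scale (G i)"
    and direct_sum: "\<exists>!c. finite {i. c i \<noteq> 0} \<and> (\<forall>i. c i \<in> G i) \<and> v = Sum_any c"
    and finite_dim: "\<exists>B. finite B \<and> module.span scale B = G i"
    and bounded_below: "\<exists>N. \<forall>i<N. G i = {0}"

definition graded_component :: "('i \<Rightarrow> 'a::comm_monoid_add set) \<Rightarrow> 'a \<Rightarrow> 'i \<Rightarrow> 'a" where
  "graded_component G v = (THE c. finite {i. c i \<noteq> 0} \<and> (\<forall>i. c i \<in> G i) \<and> v = Sum_any c)"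

section \<open>Vertex operators\<close>

text \<open>
  A vertex operator map is given by its modes, \<open>Y v n\<close> being \<open>v\<^sub>n\<close> in
  \<open>Y(v,x) = \<Sum>\<^sub>n v\<^sub>n x\<^bsup>-n-1\<^esup>\<close>. Modes are indexed by rational numbers and vanish outside \<open>\<int>\<close>, respectively
  \<open>(1/p)\<int>\<close>. \<open>vertex_series Y v q\<close> is the coefficient of \<open>x\<^sup>q\<close> in \<open>Y(v,x)\<close>.
\<close>

definition vertex_series :: "('v \<Rightarrow> rat \<Rightarrow> 'm \<Rightarrow> 'm) \<Rightarrow> 'v \<Rightarrow> rat \<Rightarrow> 'm \<Rightarrow> 'm" where
  "vertex_series Y v q = Y v (- q - 1)"

text \<open>The coefficient of \<open>x\<^sup>q\<close> in \<open>X(v,x) = Y(x\<^bsup>L(0)\<^esup> v, x)\<close>; here \<open>x\<^bsup>L(0)\<^esup> v = \<Sum>\<^sub>k x\<^sup>k v\<^sub>(\<^sub>k\<^sub>)\<close>.\<close>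

definition hom_vertex_series ::
  "(int \<Rightarrow> 'v::ab_group_add set) \<Rightarrow> ('v \<Rightarrow> rat \<Rightarrow> 'm \<Rightarrow> 'm) \<Rightarrow> 'v \<Rightarrow> rat \<Rightarrow> 'm \<Rightarrow> 'm::ab_group_add" where
  "hom_vertex_series G Y v q w =
     Sum_any (\<lambda>k. vertex_series Y (graded_component G v k) (q - of_int k) w)"

definition Lop :: "('v \<Rightarrow> rat \<Rightarrow> 'm \<Rightarrow> 'm) \<Rightarrow> 'v \<Rightarrow> int \<Rightarrow> 'm \<Rightarrow> 'm" where
  "Lop Y \<omega> n = Y \<omega> (of_int n + 1)"

definition virasoro_relations ::
  "(complex \<Rightarrow> 'm::ab_group_add \<Rightarrow> 'm) \<Rightarrow> complex \<Rightarrow> (int \<Rightarrow> 'm \<Rightarrow> 'm) \<Rightarrow> bool" where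
  "virasoro_relations scale c L \<longleftrightarrow>
     (\<forall>m n w. L m (L n w) - L n (L m w) =
        scale (of_int (m - n)) (L (m + n) w)
        + scale (if m + n = 0 then c * (of_int (m ^ 3 - m) / 12) else 0) w)"

text \<open>
  For operator series \<open>F(x)\<close>, \<open>H(x)\<close> given by their coefficients, the series
  \<open>x\<^sub>0\<^bsup>-1\<^esup> \<delta>((x\<^sub>1-x\<^sub>2)/x\<^sub>0) F(x\<^sub>1) H(x\<^sub>2) w - x\<^sub>0\<^bsup>-1\<^esup> \<delta>((x\<^sub>2-x\<^sub>1)/(-x\<^sub>0)) H(x\<^sub>2) F(x\<^sub>1) w\<close>.
\<close>

definition jacobi_lhs ::
  "(complex \<Rightarrow> 'm::ab_group_add \<Rightarrow> 'm) \<Rightarrow> (rat \<Rightarrow> 'm \<Rightarrow> 'm) \<Rightarrow> (rat \<Rightarrow> 'm \<Rightarrow> 'm) \<Rightarrow> 'm \<Rightarrow> 'm fseries" where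
  "jacobi_lhs scale F H w = (\<lambda>e.
     fmult scale
       (fmult (*) (monomial 1 (-1, 0, 0)) (delta_binomial 1 1 (-1, 1, 0) (-1, 0, 1) (-1)))
       (\<lambda>(a, b, c). if a = 0 then F b (H c w) else 0) e
   - fmult scale
       (fmult (*) (monomial 1 (-1, 0, 0)) (delta_binomial (-1) 1 (-1, 0, 1) (-1, 1, 0) (-1)))
       (\<lambda>(a, b, c). if a = 0 then H c (F b w) else 0) e)"

text \<open>\<open>Y\<^sub>M(Y(u,x\<^sub>0)v, x\<^sub>2) w\<close>\<close>

definition iterate_series ::
  "('v \<Rightarrow> rat \<Rightarrow> 'v \<Rightarrow> 'v) \<Rightarrow> ('v \<Rightarrow> rat \<Rightarrow> 'm \<Rightarrow> 'm) \<Rightarrow> 'v \<Rightarrow> 'v \<Rightarrow> 'm::ab_group_add \<Rightarrow> 'm fseries" where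
  "iterate_series Y YM u v w =
     (\<lambda>(a, b, c). if b = 0 then vertex_series YM (vertex_series Y u a v) c w else 0)"

locale vertex_operator_algebra = graded_space scale G
  for scale :: "complex \<Rightarrow> 'v::ab_group_add \<Rightarrow> 'v" and G :: "int \<Rightarrow> 'v set" +
  fixes Y :: "'v \<Rightarrow> rat \<Rightarrow> 'v \<Rightarrow> 'v" and vac :: 'v and \<omega> :: 'v and c :: complex
  assumes linear_left: "Vector_Spaces.linear scale scale (\<lambda>v. Y v n w)"
    and linear_mode: "Vector_Spaces.linear scale scale (Y v n)"
    and integral_modes: "n \<notin> \<int> \<Longrightarrow> Y v n w = 0"
    and truncation: "\<exists>N. \<forall>n\<ge>N. Y v n w = 0"
    and vacuum: "Y vac n w = (if n = -1 then w else 0)"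
    and creation: "(\<forall>n\<ge>0. Y v n vac = 0) \<and> Y v (-1) vac = v"
    and virasoro: "virasoro_relations scale c (Lop Y \<omega>)"
    and L0_grading: "v \<in> G k \<Longrightarrow> Lop Y \<omega> 0 v = scale (of_int k) v"
    and L_minus1_derivative:
      "vertex_series Y (Lop Y \<omega> (-1) u) q w = scale (of_rat (q + 1)) (vertex_series Y u (q + 1) w)"
    and jacobi: "jacobi_lhs scale (vertex_series Y u) (vertex_series Y v) w =
      fmult scale
        (fmult (*) (monomial 1 (0, 0, -1)) (delta_binomial 1 1 (0, 1, -1) (1, 0, -1) (-1)))
        (iterate_series Y Y u v w)"

locale voa_automorphism = vertex_operator_algebra scale G Y vac \<omega> c
  for scale :: "complex \<Rightarrow> 'v::ab_group_add \<Rightarrow> 'v" and G Y vac \<omega> c +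
  fixes \<nu> :: "'v \<Rightarrow> 'v"
  assumes linear: "Vector_Spaces.linear scale scale \<nu>"
    and bij: "bij \<nu>"
    and preserves_vacuum: "\<nu> vac = vac"
    and preserves_conformal: "\<nu> \<omega> = \<omega>"
    and conjugation: "\<nu> \<circ> Y v n \<circ> inv \<nu> = Y (\<nu> v) n"

text \<open>
  The twisted Jacobi identity depends on the chosen primitive \<open>p\<close>-th root of unity \<open>\<zeta>\<close>.
\<close>

locale twisted_module =
  V: voa_automorphism scaleV GV Y vac \<omega> c \<nu> + graded_space scaleM GM
  for scaleV :: "complex \<Rightarrow> 'v::ab_group_add \<Rightarrow> 'v" and GV Y vac \<omega> c \<nu>
    and scaleM :: "complex \<Rightarrow> 'm::ab_group_add \<Rightarrow> 'm" and GM :: "rat \<Rightarrow> 'm set" +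
  fixes p :: nat and \<zeta> :: complex and YM :: "'v \<Rightarrow> rat \<Rightarrow> 'm \<Rightarrow> 'm"
  assumes linear_left: "Vector_Spaces.linear scaleV scaleM (\<lambda>v. YM v n w)"
    and linear_mode: "Vector_Spaces.linear scaleM scaleM (YM v n)"
    and fractional_modes: "of_nat p * n \<notin> \<int> \<Longrightarrow> YM v n w = 0"
    and truncation: "\<exists>N. \<forall>n\<ge>N. YM v n w = 0"
    and vacuum: "YM vac n w = (if n = -1 then w else 0)"
    and conformal_integral: "n \<notin> \<int> \<Longrightarrow> YM \<omega> n w = 0"
    and virasoro: "virasoro_relations scaleM c (Lop YM \<omega>)"
    and L0_grading: "w \<in> GM k \<Longrightarrow> Lop YM \<omega> 0 w = scaleM (of_rat k) w"
    and L_minus1_derivative: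
      "vertex_series YM (Lop Y \<omega> (-1) u) q w
         = scaleM (of_rat (q + 1)) (vertex_series YM u (q + 1) w)"
    and twisted_jacobi: "jacobi_lhs scaleM (vertex_series YM u) (vertex_series YM v) w =
      fmult scaleM (monomial (1 / of_nat p) (0, 0, -1))
        (\<lambda>e. \<Sum>r<p.
          fmult scaleM (delta_binomial (\<zeta> ^ r) p (0, 1, -1) (1, 0, -1) (-1))
            (iterate_series Y YM ((\<nu> ^^ r) u) v w) e)"

section \<open>The operators \<open>Y[u,y]\<close>\<close>

text \<open>
  The coefficient of \<open>y\<^sup>m\<close> in \<open>Y[u,y]v = Y(e\<^bsup>yL(0)\<^esup>u, e\<^sup>y-1)v\<close>, that is, in the sum over \<open>j\<close> and \<open>n\<close> of
  \<open>(y\<^sup>j / j!) (e\<^sup>y-1)\<^bsup>-n-1\<^esup> (L(0)\<^sup>j u)\<^sub>n v\<close>, where \<open>e\<^sup>y-1\<close> is inverted in the field of Laurent series in \<open>y\<close>.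
\<close>

definition bracket_series ::
  "(complex \<Rightarrow> 'v::ab_group_add \<Rightarrow> 'v) \<Rightarrow> ('v \<Rightarrow> rat \<Rightarrow> 'v \<Rightarrow> 'v) \<Rightarrow> 'v \<Rightarrow> 'v \<Rightarrow> 'v \<Rightarrow> int \<Rightarrow> 'v" where
  "bracket_series scale Y \<omega> u v m =
     Sum_any (\<lambda>(j::nat, n::int).
       scale (fls_nth (fls_X ^ j * fls_const (1 / fact j) * fps_to_fls (fps_exp 1 - 1) powi (- n - 1)) m)
             (Y ((Lop Y \<omega> 0 ^^ j) u) (of_int n) v))"

text \<open>\<open>X\<^sub>M(Y[u,y]v, x\<^sub>2) w\<close>, a series in \<open>y, x\<^sub>1, x\<^sub>2\<close>\<close>

definition hom_iterate_series ::
  "(complex \<Rightarrow> 'v::ab_group_add \<Rightarrow> 'v) \<Rightarrow> (int \<Rightarrow> 'v set) \<Rightarrow> ('v \<Rightarrow> rat \<Rightarrow> 'v \<Rightarrow> 'v) \<Rightarrow> 'v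
     \<Rightarrow> ('v \<Rightarrow> rat \<Rightarrow> 'm \<Rightarrow> 'm) \<Rightarrow> 'v \<Rightarrow> 'v \<Rightarrow> 'm::ab_group_add \<Rightarrow> 'm fseries" where
  "hom_iterate_series scale G Y \<omega> YM u v w =
     (\<lambda>(a, b, c). if a \<in> \<int> \<and> b = 0
        then hom_vertex_series G YM (bracket_series scale Y \<omega> u v \<lfloor>a\<rfloor>) c w else 0)"

end

theory Submission
  imports Defs
begin

text \<open>
  Both sides are additive in \<open>u\<close> and \<open>v\<close>, so \<open>u\<close> and \<open>v\<close> may be taken homogeneous of weights \<open>h\<close> and
  \<open>l\<close>. Then \<open>X\<^sub>M(u,x\<^sub>1) = x\<^sub>1\<^sup>h Y\<^sub>M(u,x\<^sub>1)\<close> and \<open>X\<^sub>M(v,x\<^sub>2) = x\<^sub>2\<^sup>l Y\<^sub>M(v,x\<^sub>2)\<close>, and the left-hand side is the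
  twisted Jacobi identity multiplied by \<open>x\<^sub>1\<^sup>h x\<^sub>2\<^sup>l\<close>. On the right, the \<delta>-function of \<open>(e\<^sup>y x\<^sub>2/x\<^sub>1)\<^bsup>1/p\<^esup>\<close>
  contributes \<open>e\<^bsup>-by\<^esup>\<close> to the coefficient of \<open>x\<^sub>1\<^sup>b\<close>, while the component of \<open>Y[u,y]v\<close> along \<open>u\<^sub>n v\<close>, which has
  weight \<open>h + l - n - 1\<close>, is \<open>e\<^bsup>hy\<^esup> (e\<^sup>y - 1)\<^bsup>-n-1\<^esup>\<close>. Substituting \<open>y = log (1 + t)\<close> turns their product into
  \<open>(1 + t)\<^bsup>h-b\<^esup> t\<^bsup>-n-1\<^esup>\<close>, whose binomial coefficients are those of \<open>\<delta>(((x\<^sub>1 - x\<^sub>0)/x\<^sub>2)\<^bsup>1/p\<^esup>)\<close> by the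
  identity \<open>binom(z, i) = (-1)\<^sup>i binom(i - z - 1, i)\<close>.
\<close>

section \<open>Finitely supported sums and Laurent series\<close>

text \<open>Injectivity carries the support of the composite bijectively onto the support of
  \<open>g\<close>. Infinite supports, where \<open>Sum_any\<close> is 0 by default, therefore
  correspond as well.\<close>

lemma Sum_any_reindex_inj:
  assumes "inj \<iota>" and "\<And>y. y \<notin> range \<iota> \<Longrightarrow> g y = 0"
  shows "Sum_any g = Sum_any (\<lambda>x. g (\<iota> x))"
proof -
  have "{y. g y \<noteq> 0} = \<iota> ` {x. g (\<iota> x) \<noteq> 0}"
    using assms(2) by (auto simp: image_iff) metis
  then show ?thesis
    using assms(1) by (simp add: Sum_any.expand_set sum.reindex inj_on_def)
qed

text \<open>Collapses the double sums that come from delta functions: there the exponent of one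
  variable determines the power \<open>n\<close> from the expansion index \<open>i\<close>.\<close>

lemma Sum_any_graph:
  assumes "\<And>n i. n \<noteq> \<phi> i \<Longrightarrow> g (n, i) = 0"
  shows "Sum_any g = Sum_any (\<lambda>i. g (\<phi> i, i))"
  using assms by (intro Sum_any_reindex_inj[of "\<lambda>i. (\<phi> i, i)"]) (auto simp: inj_on_def image_iff)

lemma Sum_any_zero: "(\<And>x. g x = 0) \<Longrightarrow> Sum_any g = 0"
  by simp

lemma (in vector_space) Sum_any_scale_sum:
  assumes "finite I" and "\<And>n. n \<in> I \<Longrightarrow> finite {k. f n k \<noteq> 0}"
  shows "Sum_any (\<lambda>k. \<Sum>n\<in>I. scale (f n k) (x n)) = (\<Sum>n\<in>I. scale (Sum_any (f n)) (x n))"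
proof -
  define K where "K = (\<Union>n\<in>I. {k. f n k \<noteq> 0})"
  have K: "finite K" unfolding K_def using assms by auto
  have "Sum_any (\<lambda>k. \<Sum>n\<in>I. scale (f n k) (x n)) = (\<Sum>k\<in>K. \<Sum>n\<in>I. scale (f n k) (x n))"
  proof (intro Sum_any.expand_superset K subsetI)
    fix k assume "k \<in> {k. (\<Sum>n\<in>I. scale (f n k) (x n)) \<noteq> 0}"
    then obtain n where "n \<in> I" "scale (f n k) (x n) \<noteq> 0"
      by (metis (mono_tags, lifting) mem_Collect_eq sum.neutral)
    then show "k \<in> K" by (auto simp: K_def)
  qed
  also have "\<dots> = (\<Sum>n\<in>I. scale (\<Sum>k\<in>K. f n k) (x n))"
    by (simp add: sum.swap[of _ K] scale_sum_left)
  also have "\<dots> = (\<Sum>n\<in>I. scale (Sum_any (f n)) (x n))"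
    by (intro sum.cong refl arg_cong2[of _ _ _ _ scale] sym[OF Sum_any.expand_superset] K)
       (auto simp: K_def)
  finally show ?thesis .
qed

section \<open>Coefficients of products and compositions of Laurent series\<close>

lemma finite_fps_convolution:
  fixes f :: "'a::comm_semiring_1 fps"
  shows "finite {k. fps_nth f k * fls_nth g (m - int k) \<noteq> 0}"
proof (rule finite_subset)
  show "{k. fps_nth f k * fls_nth g (m - int k) \<noteq> 0} \<subseteq> {..nat (m - fls_subdegree g)}"
  proof
    fix k assume "k \<in> {k. fps_nth f k * fls_nth g (m - int k) \<noteq> 0}"
    then have "fls_nth g (m - int k) \<noteq> 0" by auto
    then show "k \<in> {..nat (m - fls_subdegree g)}"
      using fls_eq0_below_subdegree[of "m - int k" g] by (cases "m - int k < fls_subdegree g") auto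
  qed
qed simp

lemma fps_to_fls_times_nth:
  fixes f :: "'a::comm_semiring_1 fps"
  shows "fls_nth (fps_to_fls f * g) m = Sum_any (\<lambda>k. fps_nth f k * fls_nth g (m - int k))"
proof -
  let ?t = "\<lambda>i. fls_nth (fps_to_fls f) i * fls_nth g (m - i)"
  have "fls_nth (fps_to_fls f * g) m = (\<Sum>i=fls_subdegree (fps_to_fls f)..m - fls_subdegree g. ?t i)"
    by (rule fls_times_nth(2))
  also have "\<dots> = Sum_any ?t"
  proof (rule sym[OF Sum_any.expand_superset])
    show "{i. ?t i \<noteq> 0} \<subseteq> {fls_subdegree (fps_to_fls f)..m - fls_subdegree g}"
    proof safe
      fix i assume i: "?t i \<noteq> 0"
      then have "fls_nth (fps_to_fls f) i \<noteq> 0" "fls_nth g (m - i) \<noteq> 0" by auto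
      then show "i \<in> {fls_subdegree (fps_to_fls f)..m - fls_subdegree g}"
        using fls_eq0_below_subdegree[of i "fps_to_fls f"] fls_eq0_below_subdegree[of "m - i" g]
        by (auto simp: not_less[symmetric])
    qed
  qed simp
  also have "\<dots> = Sum_any (\<lambda>k. ?t (int k))"
  proof (rule Sum_any_reindex_inj)
    fix i assume "i \<notin> range int"
    then have "i < 0" by (metis nonneg_int_cases not_less rangeI)
    then show "?t i = 0" by simp
  qed simp
  finally show ?thesis by simp
qed

text \<open>Connects composition of Laurent series with the coefficientwise sum by which
  \<open>subst_log\<close> is defined. With s the subdegree of F, write F as X^s times a power
  series B. Then the composite is B(H) H^s, and H^(s+i) has ever higher order because H has no
  constant term.\<close>

lemma fls_compose_fps_nth:
  fixes H :: "'a::field fps"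
  assumes H: "H \<noteq> 0" "fps_nth H 0 = 0"
  shows "fls_nth (fls_compose_fps F H) m = Sum_any (\<lambda>j. fls_nth F j * fls_nth (fps_to_fls H powi j) m)"
proof -
  let ?s = "fls_subdegree F" and ?B = "fls_base_factor_to_fps F"
  let ?K = "fps_to_fls H powi fls_subdegree F"
  let ?t = "\<lambda>j. fls_nth F j * fls_nth (fps_to_fls H powi j) m"
  have K: "?K * fps_to_fls H ^ i = fps_to_fls H powi (?s + int i)" for i
    using H by (simp add: power_int_add)
  have below: "fls_nth (fps_to_fls H powi (?s + int i)) m = 0" if "m - fls_subdegree ?K < int i" for i
  proof -
    have "subdegree H \<ge> 1" using H subdegree_eq_0_iff[of H] by simp
    then have "int i \<le> int i * int (subdegree H)"
      by (simp add: mult_le_cancel_left1)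
    then show ?thesis using that
      by (intro fls_eq0_below_subdegree) (auto simp: fls_subdegree_fls_to_fps algebra_simps)
  qed
  \<comment> \<open>One cutoff for all sums: for k > A the coefficient of H^s at m - k vanishes, and
    for i > A so does the coefficient of H^(s+i) at m.\<close>
  define A where "A = nat (m - fls_subdegree ?K)"
  have "fls_nth (fls_compose_fps F H) m = Sum_any (\<lambda>k. fps_nth (?B oo H) k * fls_nth ?K (m - int k))"
    by (simp add: fls_compose_fps_def fps_to_fls_times_nth)
  also have "\<dots> = (\<Sum>k\<le>A. fps_nth (?B oo H) k * fls_nth ?K (m - int k))"
    by (intro Sum_any.expand_superset) (auto simp: A_def fls_eq0_below_subdegree intro: ccontr)
  also have "\<dots> = (\<Sum>k\<le>A. (\<Sum>i\<le>A. fps_nth ?B i * fps_nth (H ^ i) k) * fls_nth ?K (m - int k))"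
  proof (intro sum.cong refl arg_cong2[of _ _ _ _ "(*)"])
    fix k assume "k \<in> {..A}"
    \<comment> \<open>H^i starts in degree i or later, so the sum over i <= k that defines the
      composition may be extended to i <= A.\<close>
    moreover have "fps_nth (H ^ i) k = 0" if "k < i" for i
      using startsby_zero_power_prefix[OF H(2)] that by blast
    ultimately show "fps_nth (?B oo H) k = (\<Sum>i\<le>A. fps_nth ?B i * fps_nth (H ^ i) k)"
      unfolding fps_compose_nth by (intro sum.mono_neutral_left) auto
  qed
  also have "\<dots> = (\<Sum>i\<le>A. fps_nth ?B i * (\<Sum>k\<le>A. fps_nth (H ^ i) k * fls_nth ?K (m - int k)))"
    unfolding sum_distrib_left sum_distrib_right mult.assoc by (rule sum.swap)
  also have "\<dots> = (\<Sum>i\<le>A. fps_nth ?B i * fls_nth (fps_to_fls (H ^ i) * ?K) m)"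
    unfolding fps_to_fls_times_nth
    by (intro sum.cong refl arg_cong2[of _ _ _ _ "(*)"] sym[OF Sum_any.expand_superset])
       (auto simp: A_def fls_eq0_below_subdegree intro: ccontr)
  also have "\<dots> = (\<Sum>i\<le>A. ?t (?s + int i))"
    by (simp add: fps_to_fls_power K mult.commute[of "_ ^ _"] add.commute)
  also have "\<dots> = Sum_any (\<lambda>i. ?t (?s + int i))"
    by (intro sym[OF Sum_any.expand_superset]) (auto simp: A_def below intro: ccontr)
  also have "\<dots> = Sum_any ?t"
  proof (rule sym[OF Sum_any_reindex_inj])
    fix j assume "j \<notin> range (\<lambda>i. ?s + int i)"
    then have "\<not> ?s \<le> j" unfolding zle_iff_zadd by auto
    then show "?t j = 0" by simp
  qed (simp add: inj_on_def)
  finally show ?thesis .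
qed

text \<open>The chain rule gives f' = c f / (1 + X), and this equation with its initial value
  characterises the binomial series.\<close>

lemma fps_exp_compose_ln:
  "fps_exp (c::'a::field_char_0) oo fps_ln 1 = fps_binomial c"
proof -
  have "fps_deriv (fps_exp c oo fps_ln 1) = fps_const c * (fps_exp c oo fps_ln 1) / (1 + fps_X)"
    by (simp add: fps_compose_deriv fps_ln_deriv fps_compose_mult_distrib fps_divide_unit mult.assoc)
  then show ?thesis
    by (subst fps_binomial_ODE_unique'[symmetric]) simp
qed

lemma fps_ln_nonzero: "fps_ln (1::'a::field_char_0) \<noteq> 0"
  by (metis fps_ln_nth fps_zero_nth div_by_1 diff_self_eq_0 mult_1 of_nat_1 one_neq_zero power_0)

text \<open>log (1 + X) has order exactly 1, so its j-th power has order j, also for negative j.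
  This bounds the sum over j in \<open>subst_log\<close> from above.\<close>

lemma fls_ln_powi_nth_eq_0:
  assumes "m < j"
  shows "fls_nth (fps_to_fls (fps_ln (1::'a::field_char_0)) powi j) m = 0"
proof -
  have "subdegree (fps_ln (1::'a)) = 1"
    by (rule subdegreeI) (auto simp: fps_ln_nth)
  then show ?thesis using assms
    by (intro fls_eq0_below_subdegree) (simp add: fls_subdegree_fls_to_fps)
qed

lemma fls_exp_minus_1_powi_nth_eq_0:
  assumes "m < j"
  shows "fls_nth (fps_to_fls (fps_exp (1::'a::field_char_0) - 1) powi j) m = 0"
proof -
  have "subdegree (fps_exp (1::'a) - 1) = 1"
    by (rule subdegreeI) auto
  then show ?thesis using assms
    by (intro fls_eq0_below_subdegree) (simp add: fls_subdegree_fls_to_fps del: fps_to_fls_minus)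
qed

text \<open>Composition respects products and integer powers, and it sends e^(\<alpha>y) to (1 +
  t)^\<alpha> and e^y - 1 to t.\<close>

lemma fls_compose_exp_ln:
  fixes \<alpha> :: "'a::field_char_0"
  shows "fls_compose_fps (fps_to_fls (fps_exp \<alpha>) * fps_to_fls (fps_exp 1 - 1) powi n) (fps_ln 1)
     = fps_to_fls (fps_binomial \<alpha>) * fls_X powi n"
proof -
  note ln0 = fps_ln_nonzero[where 'a='a]
  have "(fps_exp 1 - 1 :: 'a fps) oo fps_ln 1 = fps_X"
    by (simp add: fps_compose_sub_distrib fps_exp_compose_ln fps_binomial_1)
  then have "fls_compose_fps (fps_to_fls (fps_exp 1 - 1 :: 'a fps)) (fps_ln 1) = fls_X"
    using ln0 by (simp del: fps_to_fls_minus)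
  then show ?thesis using ln0
    by (simp add: fls_compose_fps_mult fls_compose_fps_powi fps_exp_compose_ln del: fps_to_fls_minus)
qed

section \<open>Delta functions and graded spaces\<close>

text \<open>
  The pair \<open>(n, i)\<close> stands for the \<open>i\<close>-th term of the expansion of the \<open>n\<close>-th power in \<open>\<delta>\<close>; for the
  exponents that occur, distinct pairs give distinct monomials, so no coefficient is an actual sum.
\<close>

definition delta_expo :: "nat \<Rightarrow> expo \<Rightarrow> expo \<Rightarrow> int \<times> nat \<Rightarrow> expo" where
  "delta_expo p a b = (\<lambda>(n, i). expo_scale (of_int n / of_nat p - of_nat i) a + expo_scale (of_nat i) b)"

definition delta_coeff :: "complex \<Rightarrow> nat \<Rightarrow> complex \<Rightarrow> int \<times> nat \<Rightarrow> complex" where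
  "delta_coeff \<alpha> p \<beta> = (\<lambda>(n, i). \<alpha> powi n * ((of_rat (of_int n / of_nat p) gchoose i) * \<beta> ^ i))"

lemma delta_binomial_nth:
  assumes inj: "inj (delta_expo p a b)"
  shows "delta_binomial \<alpha> p a b \<beta> (delta_expo p a b x) = delta_coeff \<alpha> p \<beta> x"
proof (cases x)
  case (Pair n i)
  have *: "expo_scale (of_int n / of_nat p - of_nat i) a + expo_scale (of_nat i) b =
     expo_scale (of_int m / of_nat p - of_nat k) a + expo_scale (of_nat k) b \<longleftrightarrow> m = n \<and> k = i" for m k
    using inj_eq[OF inj, of "(n, i)" "(m, k)"] by (auto simp: delta_expo_def)
  have "Sum_any (\<lambda>k. if m = n \<and> k = i then z else 0) = (if m = n then z else 0)"
    for m and z :: complex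
    by (cases "m = n") simp_all
  then show ?thesis
    by (simp add: Pair delta_binomial_def binomial_pow_def fsum_def monomial_def delta_expo_def
        delta_coeff_def * if_distrib[of "(*) _"] cong: if_cong)
qed

lemma delta_binomial_eq_0:
  assumes "e \<notin> range (delta_expo p a b)"
  shows "delta_binomial \<alpha> p a b \<beta> e = 0"
proof -
  have "e \<noteq> expo_scale (of_int n / of_nat p - of_nat k) a + expo_scale (of_nat k) b" for n k
    using assms by (auto simp: delta_expo_def)
  then show ?thesis
    by (simp add: delta_binomial_def binomial_pow_def fsum_def monomial_def)
qed

definition delta_exp_expo :: "nat \<Rightarrow> int \<times> nat \<Rightarrow> expo" where
  "delta_exp_expo p = (\<lambda>(n, j). (of_nat j, - of_int n / of_nat p, of_int n / of_nat p))"

lemma inj_delta_exp_expo: "p > 0 \<Longrightarrow> inj (delta_exp_expo p)"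
  by (auto simp: inj_on_def delta_exp_expo_def)

lemma delta_exp_nth:
  assumes "p > 0"
  shows "delta_exp \<alpha> p (delta_exp_expo p (n, j)) = \<alpha> powi n * fps_nth (fps_exp (of_int n / of_nat p)) j"
proof -
  have "Sum_any (\<lambda>k. if j = k \<and> n = m then f k else 0) = (if n = m then f j else 0)"
    for m and f :: "nat \<Rightarrow> complex"
    by (cases "n = m") simp_all
  then show ?thesis using assms
    by (simp add: delta_exp_def fsum_def monomial_def delta_exp_expo_def
        if_distrib[of "(*) _"] del: fps_exp_nth cong: if_cong)
qed

lemma delta_exp_eq_0:
  assumes "e \<notin> range (delta_exp_expo p)"
  shows "delta_exp \<alpha> p e = 0"
proof -
  have "e \<noteq> (of_nat j, - of_int n / of_nat p, of_int n / of_nat p)" for n j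
    using assms by (auto simp: delta_exp_expo_def image_iff)
  then show ?thesis
    by (simp add: delta_exp_def fsum_def monomial_def)
qed

text \<open>The exponents for the three delta functions in use, those of (x_1 - x_2)/x_0, of (x_2 -
  x_1)/x_0 up to sign, and of ((x_1 - x_0)/x_2)^(1/p). \<open>Suc 0\<close> is the form that 1 takes
  under simplification.\<close>

lemma delta_expo_eq:
  "delta_expo (Suc 0) (-1, 1, 0) (-1, 0, 1) x =
     (- of_int (fst x), of_int (fst x) - of_nat (snd x), of_nat (snd x))"
  "delta_expo (Suc 0) (-1, 0, 1) (-1, 1, 0) x =
     (- of_int (fst x), of_nat (snd x), of_int (fst x) - of_nat (snd x))"
  "delta_expo p (0, 1, -1) (1, 0, -1) x =
     (of_nat (snd x), of_int (fst x) / of_nat p - of_nat (snd x), - of_int (fst x) / of_nat p)"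
  by (simp_all add: delta_expo_def expo_scale_def case_prod_unfold)

lemma inj_delta_expo:
  "inj (delta_expo (Suc 0) (-1, 1, 0) (-1, 0, 1))"
  "inj (delta_expo (Suc 0) (-1, 0, 1) (-1, 1, 0))"
  "p > 0 \<Longrightarrow> inj (delta_expo p (0, 1, -1) (1, 0, -1))"
  by (auto simp: inj_on_def delta_expo_eq prod_eq_iff)

section \<open>Multiplication by monomials and delta series\<close>

locale complex_vector_space = vector_space scale
  for scale :: "complex \<Rightarrow> 'a::ab_group_add \<Rightarrow> 'a"
begin

lemma fmult_monomial: "fmult scale (monomial a d) g e = scale a (g (e - d))"
proof -
  have "scale (monomial a d d') x = (if d' = d then scale a x else 0)" for d' x
    by (simp add: monomial_def)
  then show ?thesis by (simp add: fmult_def)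
qed

lemma fmult_shift: "fmult scale (\<lambda>e. f (e - d)) g e = fmult scale f g (e - d)"
proof -
  have "bij (\<lambda>d'. d' + d)" by (rule bij_plus_right)
  then show ?thesis unfolding fmult_def
    by (rule Sum_any.reindex_cong) (auto simp: fun_eq_iff algebra_simps)
qed

lemma fmult_reindex:
  assumes "inj \<iota>" "\<And>x. f (\<iota> x) = k x" "\<And>e. e \<notin> range \<iota> \<Longrightarrow> f e = 0"
  shows "fmult scale f g e = Sum_any (\<lambda>x. scale (k x) (g (e - \<iota> x)))"
  unfolding fmult_def
  by (subst Sum_any_reindex_inj[OF assms(1)]) (simp_all add: assms)

lemma fmult_delta_binomial:
  assumes "inj (delta_expo p a b)"
  shows "fmult scale (delta_binomial \<alpha> p a b \<beta>) g e =
    Sum_any (\<lambda>x. scale (delta_coeff \<alpha> p \<beta> x) (g (e - delta_expo p a b x)))"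
  using assms by (intro fmult_reindex) (auto simp: delta_binomial_nth delta_binomial_eq_0)

lemma fmult_delta_exp:
  assumes "p > 0"
  shows "fmult scale (delta_exp \<alpha> p) g e =
    Sum_any (\<lambda>x. scale (delta_exp \<alpha> p (delta_exp_expo p x)) (g (e - delta_exp_expo p x)))"
  using assms by (intro fmult_reindex inj_delta_exp_expo) (auto simp: delta_exp_eq_0)

end

lemma fmult_mult_monomial: "fmult (*) (monomial a d) f = (\<lambda>e. a * f (e - d))"
proof
  fix e
  have "monomial a d d' * x = (if d' = d then a * x else 0)" for d' x
    by (simp add: monomial_def)
  then show "fmult (*) (monomial a d) f e = a * f (e - d)" by (simp add: fmult_def)
qed

context complex_vector_space
begin

text \<open>The operator products are free of x_0, so the exponent a of x_0 forces n = -a - 1. The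
  index i is the power of x_2 in the first expansion and of x_1 in the second.\<close>

lemma jacobi_lhs_eq:
  "jacobi_lhs scale F H w (a, b, c) =
    Sum_any (\<lambda>(n, i). scale (delta_coeff 1 1 (-1) (n, i))
      (if a + 1 + of_int n = 0 then F (b - of_int n + of_nat i) (H (c - of_nat i) w) else 0))
  - Sum_any (\<lambda>(n, i). scale (delta_coeff (-1) 1 (-1) (n, i))
      (if a + 1 + of_int n = 0 then H (c - of_int n + of_nat i) (F (b - of_nat i) w) else 0))"
  by (simp add: jacobi_lhs_def fmult_mult_monomial fmult_shift fmult_delta_binomial inj_delta_expo
      case_prod_unfold delta_expo_eq algebra_simps cong: if_cong)

end

section \<open>Homogeneous components and eigenvectors of the grading operator\<close>

sublocale graded_space \<subseteq> complex_vector_space ..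

lemma (in graded_space) zero_mem: "0 \<in> G i"
  using subspace_G subspace_0 by blast

context graded_space
begin

lemma graded_component_eqI:
  assumes "finite {i. k i \<noteq> 0}" "\<And>i. k i \<in> G i" "v = Sum_any k"
  shows "graded_component G v = k"
  unfolding graded_component_def using assms
  by (intro the1_equality direct_sum) auto

lemma graded_component:
  shows finite_graded_component: "finite {i. graded_component G v i \<noteq> 0}"
    and graded_component_mem: "graded_component G v i \<in> G i"
    and Sum_any_graded_component: "Sum_any (graded_component G v) = v"
  using theI'[OF direct_sum[of v]] unfolding graded_component_def by auto

lemma graded_component_homogeneous:
  "v \<in> G k \<Longrightarrow> graded_component G v = (\<lambda>i. if i = k then v else 0)"
  by (rule graded_component_eqI) (auto simp: zero_mem)

lemma graded_component_add:
  "graded_component G (v + v') = (\<lambda>i. graded_component G v i + graded_component G v' i)"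
proof (rule graded_component_eqI)
  show "finite {i. graded_component G v i + graded_component G v' i \<noteq> 0}"
    by (rule finite_subset[OF _ finite_UnI[OF finite_graded_component[of v] finite_graded_component[of v']]])
       auto
  show "graded_component G v i + graded_component G v' i \<in> G i" for i
    using subspace_G subspace_add graded_component_mem by blast
qed (simp add: Sum_any.distrib finite_graded_component Sum_any_graded_component)

lemma linear_Sum_any:
  assumes "Vector_Spaces.linear scale s' f" "finite {i. k i \<noteq> 0}"
  shows "f (Sum_any k) = Sum_any (\<lambda>i. f (k i))"
proof -
  interpret f: Vector_Spaces.linear scale s' f by fact
  show ?thesis
    using f.sum[of k "{i. k i \<noteq> 0}"] Sum_any.expand_superset[OF assms(2), of "\<lambda>i. f (k i)"]
    by (simp add: Sum_any.expand_set[of k] Collect_mono_iff) (metis f.zero)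
qed

lemma graded_component_scale:
  "graded_component G (scale a v) = (\<lambda>i. scale a (graded_component G v i))"
proof (rule graded_component_eqI)
  show "finite {i. scale a (graded_component G v i) \<noteq> 0}"
    by (rule finite_subset[OF _ finite_graded_component[of v]]) auto
  show "scale a (graded_component G v i) \<in> G i" for i
    using subspace_G subspace_scale graded_component_mem by blast
  show "scale a v = (\<Sum>i. scale a (graded_component G v i))"
    using linear_Sum_any[OF linear_scale_self[of a] finite_graded_component[of v]]
    by (simp add: Sum_any_graded_component)
qed

text \<open>Every vector is the finite sum of its components; the empty sum is covered because 0 is
  homogeneous of every degree.\<close>

lemma graded_induct [consumes 0, case_names homogeneous add]:
  assumes "\<And>k v. v \<in> G k \<Longrightarrow> P v" "\<And>v v'. P v \<Longrightarrow> P v' \<Longrightarrow> P (v + v')"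
  shows "P v"
proof -
  have "P (\<Sum>i\<in>A. graded_component G v i)" if "finite A" for A
    using that
  proof induction
    case empty
    show ?case using assms(1)[OF zero_mem] by simp
  qed (simp add: assms(2) assms(1)[OF graded_component_mem])
  then show ?thesis
    by (metis Sum_any_graded_component Sum_any.expand_set finite_graded_component)
qed

text \<open>Comparing components of \<open>f v\<close> in two ways gives t_i v_i = t_k v_i, and
  since the t_i are distinct only the component of degree k survives.\<close>

lemma mem_grade_of_eigenvector:
  assumes f: "Vector_Spaces.linear scale scale f"
    and eig: "\<And>i x. x \<in> G i \<Longrightarrow> f x = scale (t i) x" and t: "inj t"
    and v: "f v = scale (t k) v"
  shows "v \<in> G k"
proof -
  let ?k = "graded_component G v"
  have "graded_component G (f v) = (\<lambda>i. scale (t i) (?k i))"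
  proof (rule graded_component_eqI)
    show "finite {i. scale (t i) (?k i) \<noteq> 0}"
      by (rule finite_subset[OF _ finite_graded_component[of v]]) auto
    show "scale (t i) (?k i) \<in> G i" for i
      using subspace_G subspace_scale graded_component_mem by blast
    show "f v = (\<Sum>i. scale (t i) (?k i))"
      using linear_Sum_any[OF f finite_graded_component[of v]] eig[OF graded_component_mem]
      by (simp add: Sum_any_graded_component)
  qed
  then have "scale (t i) (?k i) = scale (t k) (?k i)" for i
    using v by (metis graded_component_scale)
  then have "?k i = 0" if "i \<noteq> k" for i
    using that t by (metis scale_cancel_right inj_eq)
  then have "Sum_any ?k = (\<Sum>i\<in>{k}. ?k i)" by (intro Sum_any.expand_superset) auto
  then have "v = ?k k" by (simp add: Sum_any_graded_component)
  then show ?thesis using graded_component_mem[of v k] by simp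
qed

end

section \<open>Substitution of the logarithm\<close>

lemma fls_binomial_X_powi_nth:
  "fls_nth (fps_to_fls (fps_binomial (\<alpha>::'a::field_char_0)) * fls_X powi k) m =
     (if m < k then 0 else \<alpha> gchoose nat (m - k))"
  by (simp add: fls_X_intpow_times_conv_shift)

lemma mult_floor_Ints: "x \<in> \<int> \<Longrightarrow> of_int \<lfloor>x\<rfloor> = (x::rat)"
  by (metis Ints_cases floor_of_int)

text \<open>Keeps of \<open>hom_iterate_series\<close> only its shape: x_1 does not occur and the
  powers of y are integral.\<close>

definition integral_series :: "(int \<Rightarrow> rat \<Rightarrow> 'm::zero) \<Rightarrow> 'm fseries" where
  "integral_series g = (\<lambda>(a, b, c). if a \<in> \<int> \<and> b = 0 then g \<lfloor>a\<rfloor> c else 0)"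

text \<open>
  The summand of the right-hand side as a function of the coefficients \<open>g m d\<close> of \<open>y\<^sup>m x\<^sub>2\<^sup>d\<close> in
  \<open>X\<^sub>M(Y[u,y]v, x\<^sub>2) w\<close>.
\<close>

definition exp_log_subst ::
  "(complex \<Rightarrow> 'm \<Rightarrow> 'm) \<Rightarrow> complex \<Rightarrow> nat \<Rightarrow> (int \<Rightarrow> rat \<Rightarrow> 'm::comm_monoid_add) \<Rightarrow> 'm fseries" where
  "exp_log_subst scale \<alpha> p g = subst_log scale (fmult scale (delta_exp \<alpha> p) (integral_series g))"

context complex_vector_space
begin

text \<open>Only the delta function contains x_1, and its n-th term has x_1 to the power -n/p. Hence
  the exponent b selects n = -pb, which must be an integer, and the exponential factor becomes
  e^(-by).\<close>

lemma fmult_delta_exp_integral_series: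
  assumes p: "p > 0"
  shows "fmult scale (delta_exp \<alpha> p) (integral_series g) (of_int m, b, c) =
    (if of_nat p * b \<in> \<int>
     then Sum_any (\<lambda>j. scale (\<alpha> powi (- \<lfloor>of_nat p * b\<rfloor>) * fps_nth (fps_exp (of_rat (- b))) j)
                          (g (m - int j) (c + b)))
     else 0)"
proof -
  let ?t = "\<lambda>x. scale (delta_exp \<alpha> p (delta_exp_expo p x))
    (integral_series g ((of_int m, b, c) - delta_exp_expo p x))"
  have floor: "\<lfloor>rat_of_int m - rat_of_nat j\<rfloor> = m - int j" for j
    by (metis floor_of_int of_int_diff of_int_of_nat_eq)
  have t: "?t (n, j) = (if b + of_int n / of_nat p = 0
     then scale (\<alpha> powi n * fps_nth (fps_exp (of_int n / of_nat p)) j)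
       (g (m - int j) (c - of_int n / of_nat p)) else 0)" for n j
    unfolding delta_exp_nth[OF p] by (simp add: delta_exp_expo_def integral_series_def floor)
  have iff: "b + of_int n / of_nat p = 0 \<longleftrightarrow> of_int n = - (of_nat p * b)" for n
    using p by (auto simp: field_simps)
  show ?thesis
  proof (cases "of_nat p * b \<in> \<int>")
    case False
    then have "b + of_int n / of_nat p \<noteq> 0" for n
      unfolding iff by (metis Ints_of_int Ints_minus minus_minus)
    then have "?t x = 0" for x
      using t[of "fst x" "snd x"] by simp
    then have "Sum_any ?t = 0" by (rule Sum_any_zero)
    with False show ?thesis
      unfolding fmult_delta_exp[OF p] by (simp only: if_False)
  next
    case True
    define k where "k = - \<lfloor>of_nat p * b\<rfloor>"
    have k: "of_int k = - (of_nat p * b)" using True by (simp add: k_def mult_floor_Ints)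
    then have k': "of_int k / of_nat p = - b" using p by (simp add: field_simps)
    have k'': "(of_int k / of_nat p :: complex) = of_rat (- b)"
      unfolding k'[symmetric] by (simp add: of_rat_divide)
    have "Sum_any ?t = Sum_any (\<lambda>j. ?t (k, j))"
    proof (rule Sum_any_graph)
      fix n j assume "n \<noteq> k"
      then have "b + of_int n / of_nat p \<noteq> 0" unfolding iff k[symmetric] by simp
      then show "?t (n, j) = 0" by (simp only: t if_False)
    qed
    also have "\<dots> = Sum_any (\<lambda>j. scale (\<alpha> powi k * fps_nth (fps_exp (of_rat (- b))) j)
                          (g (m - int j) (c + b)))"
      unfolding t k' k'' by simp
    finally show ?thesis using True unfolding fmult_delta_exp[OF p] k_def by simp
  qed
qed

lemma exp_log_subst_eq:
  assumes p: "p > 0"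
  shows "exp_log_subst scale \<alpha> p g (a, b, c) =
    (if a \<in> \<int> \<and> of_nat p * b \<in> \<int>
     then Sum_any (\<lambda>j. scale (fls_nth (fps_to_fls (fps_ln 1) powi j) \<lfloor>a\<rfloor>)
       (Sum_any (\<lambda>k. scale (\<alpha> powi (- \<lfloor>of_nat p * b\<rfloor>) * fps_nth (fps_exp (of_rat (- b))) k)
                          (g (j - int k) (c + a + b)))))
     else 0)"
  unfolding exp_log_subst_def subst_log_def
  by (simp add: fmult_delta_exp_integral_series[OF p] del: fps_exp_nth)

text \<open>\<open>Sum_any\<close> is additive only on finite supports. A lower bound M on the
  powers of y leaves k <= j - M in the inner sum and M <= j <= a in the outer one, since log (1 +
  t)^j has order j.\<close>

lemma exp_log_subst_add:
  assumes p: "p > 0" and g: "\<And>m c. m < M \<Longrightarrow> g m c = 0" and g': "\<And>m c. m < M' \<Longrightarrow> g' m c = 0"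
  shows "exp_log_subst scale \<alpha> p (\<lambda>m c. g m c + g' m c) e =
    exp_log_subst scale \<alpha> p g e + exp_log_subst scale \<alpha> p g' e"
proof -
  obtain a b c where e: "e = (a, b, c)" by (cases e)
  have fin: "finite {k. scale (x k) (f (j - int k) c) \<noteq> 0}" if "\<And>m c. m < M \<Longrightarrow> f m c = 0"
    for x j c M and f :: "int \<Rightarrow> rat \<Rightarrow> 'a"
    by (rule finite_subset[of _ "{..nat (j - M)}"]) (use that in \<open>force simp: not_less[symmetric]\<close>, simp)
  have fin': "finite {j. scale (fls_nth (fps_to_fls (fps_ln 1) powi j) m) (Sum_any (\<lambda>k. scale (x k) (f (j - int k) c))) \<noteq> 0}"
    if "\<And>m c. m < M \<Longrightarrow> f m c = 0" for x m c M and f :: "int \<Rightarrow> rat \<Rightarrow> 'a"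
  proof (rule finite_subset[of _ "{M..m}"])
    show "{j. scale (fls_nth (fps_to_fls (fps_ln 1) powi j) m) (Sum_any (\<lambda>k. scale (x k) (f (j - int k) c))) \<noteq> 0} \<subseteq> {M..m}"
    proof
      fix j assume j: "j \<in> {j. scale (fls_nth (fps_to_fls (fps_ln 1) powi j) m) (Sum_any (\<lambda>k. scale (x k) (f (j - int k) c))) \<noteq> 0}"
      have "j \<le> m" using j fls_ln_powi_nth_eq_0[of m j, where 'a=complex] by (cases "m < j") auto
      moreover have "M \<le> j"
      proof (rule ccontr)
        assume "\<not> M \<le> j"
        then have "f (j - int k) c = 0" for k by (intro that) simp
        with j show False by simp
      qed
      ultimately show "j \<in> {M..m}" by simp
    qed
  qed simp
  show ?thesis
  proof (cases "a \<in> \<int> \<and> of_nat p * b \<in> \<int>")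
    case True
    have inner: "Sum_any (\<lambda>k. scale (x k) (g (j - int k) c + g' (j - int k) c)) =
      Sum_any (\<lambda>k. scale (x k) (g (j - int k) c)) + Sum_any (\<lambda>k. scale (x k) (g' (j - int k) c))" for x j c
      unfolding scale_right_distrib by (intro Sum_any.distrib fin[of M g, OF g] fin[of M' g', OF g'])
    show ?thesis
      unfolding e exp_log_subst_eq[OF p] if_P[OF True] inner
      unfolding scale_right_distrib
      by (intro Sum_any.distrib fin'[of M g, OF g] fin'[of M' g', OF g'])
  next
    case False
    then show ?thesis unfolding e exp_log_subst_eq[OF p] by auto
  qed
qed

text \<open>The delta function replaces \<eta> by \<eta> - b, and y = log (1 + t) then yields (1 +
  t)^(\<eta> - b) t^(-n-1), whose coefficient at t^a is the stated binomial. The expansion of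
  \<open>g\<close> is required only up to degree a because higher powers of y do not reach
  t^a.\<close>

lemma exp_log_subst_exp_powi:
  assumes p: "p > 0" and a: "a \<in> \<int>" and b: "of_nat p * b \<in> \<int>" and I: "finite I"
    and g: "\<And>m. m \<le> \<lfloor>a\<rfloor> \<Longrightarrow> g m (c + a + b) = (\<Sum>n\<in>I. scale (fls_nth (fps_to_fls (fps_exp \<eta>)
        * fps_to_fls (fps_exp 1 - 1) powi (- n - 1)) m) (x n))"
  shows "exp_log_subst scale \<alpha> p g (a, b, c) =
    (\<Sum>n\<in>I. scale (\<alpha> powi (- \<lfloor>of_nat p * b\<rfloor>) *
       (if \<lfloor>a\<rfloor> + n + 1 < 0 then 0 else (\<eta> - of_rat b) gchoose nat (\<lfloor>a\<rfloor> + n + 1))) (x n))"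
proof -
  let ?\<beta> = "\<alpha> powi (- \<lfloor>of_nat p * b\<rfloor>)"
  let ?E = "\<lambda>\<eta> n. fps_to_fls (fps_exp \<eta>) * fps_to_fls (fps_exp (1::complex) - 1) powi (- n - 1)"
  let ?L = "\<lambda>j. fls_nth (fps_to_fls (fps_ln (1::complex)) powi j) \<lfloor>a\<rfloor>"
  have E: "fps_to_fls (fps_exp (of_rat (- b))) * ?E \<eta> n = ?E (\<eta> - of_rat b) n" for n
    by (simp add: mult.assoc[symmetric] fls_times_fps_to_fls[symmetric] fps_exp_add_mult[symmetric] of_rat_minus
        del: fps_to_fls_minus)
  have inner: "Sum_any (\<lambda>k. scale (?\<beta> * fps_nth (fps_exp (of_rat (- b))) k) (g (j - int k) (c + a + b)))
    = (\<Sum>n\<in>I. scale (?\<beta> * fls_nth (?E (\<eta> - of_rat b) n) j) (x n))" if "j \<le> \<lfloor>a\<rfloor>" for j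
  proof -
    have "Sum_any (\<lambda>k. scale (?\<beta> * fps_nth (fps_exp (of_rat (- b))) k) (g (j - int k) (c + a + b)))
      = Sum_any (\<lambda>k. \<Sum>n\<in>I. scale (fps_nth (fps_exp (of_rat (- b))) k * fls_nth (?E \<eta> n) (j - int k))
         (scale ?\<beta> (x n)))"
      using that by (simp add: g scale_sum_right mult_ac del: fps_exp_nth fps_to_fls_minus)
    also have "\<dots> = (\<Sum>n\<in>I. scale (fls_nth (?E (\<eta> - of_rat b) n) j) (scale ?\<beta> (x n)))"
      unfolding E[symmetric] fps_to_fls_times_nth[of "fps_exp (of_rat (- b))"]
      by (intro Sum_any_scale_sum I finite_fps_convolution)
    finally show ?thesis by (simp add: mult.commute)
  qed
  have fin: "finite {j. fls_nth (?E (\<eta> - of_rat b) n) j * ?L j \<noteq> 0}" for n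
  proof (rule finite_subset[of _ "{fls_subdegree (?E (\<eta> - of_rat b) n)..\<lfloor>a\<rfloor>}"])
    show "{j. fls_nth (?E (\<eta> - of_rat b) n) j * ?L j \<noteq> 0} \<subseteq> {fls_subdegree (?E (\<eta> - of_rat b) n)..\<lfloor>a\<rfloor>}"
    proof
      fix j assume j: "j \<in> {j. fls_nth (?E (\<eta> - of_rat b) n) j * ?L j \<noteq> 0}"
      then have "\<not> j < fls_subdegree (?E (\<eta> - of_rat b) n)" "\<not> \<lfloor>a\<rfloor> < j"
        using fls_eq0_below_subdegree fls_ln_powi_nth_eq_0 by fastforce+
      then show "j \<in> {fls_subdegree (?E (\<eta> - of_rat b) n)..\<lfloor>a\<rfloor>}" by simp
    qed
  qed simp
  have "exp_log_subst scale \<alpha> p g (a, b, c) =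
     Sum_any (\<lambda>j. \<Sum>n\<in>I. scale (fls_nth (?E (\<eta> - of_rat b) n) j * ?L j) (scale ?\<beta> (x n)))"
    unfolding exp_log_subst_eq[OF p] using a b
  proof (simp only: simp_thms if_True, intro Sum_any.cong)
    fix j
    show "scale (?L j) (Sum_any (\<lambda>k. scale (?\<beta> * fps_nth (fps_exp (of_rat (- b))) k) (g (j - int k) (c + a + b))))
      = (\<Sum>n\<in>I. scale (fls_nth (?E (\<eta> - of_rat b) n) j * ?L j) (scale ?\<beta> (x n)))"
    proof (cases "j \<le> \<lfloor>a\<rfloor>")
      case True
      show ?thesis unfolding inner[OF True] by (simp add: scale_sum_right mult_ac del: fps_to_fls_minus)
    next
      case False
      \<comment> \<open>Beyond degree a nothing is known about \<open>g\<close>, but the coefficient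
        from the logarithm is zero.\<close>
      then have "?L j = 0" by (intro fls_ln_powi_nth_eq_0) simp
      then show ?thesis by (simp only: scale_zero_left mult_zero_right sum.neutral_const)
    qed
  qed
  \<comment> \<open>Read from right to left, the coefficient formula for compositions recognises the
    sum over j as the substitution of the logarithm.\<close>
  also have "\<dots> = (\<Sum>n\<in>I. scale (fls_nth (fls_compose_fps (?E (\<eta> - of_rat b) n) (fps_ln 1)) \<lfloor>a\<rfloor>) (scale ?\<beta> (x n)))"
    unfolding fls_compose_fps_nth[OF fps_ln_nonzero fps_ln_0]
    by (intro Sum_any_scale_sum I fin)
  also have "\<dots> = (\<Sum>n\<in>I. scale (?\<beta> *
       (if \<lfloor>a\<rfloor> + n + 1 < 0 then 0 else (\<eta> - of_rat b) gchoose nat (\<lfloor>a\<rfloor> + n + 1))) (x n))"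
    unfolding fls_compose_exp_ln fls_binomial_X_powi_nth
    by (intro sum.cong refl) (auto simp: algebra_simps intro!: arg_cong[of _ _ nat])
  finally show ?thesis .
qed

end

section \<open>Additivity and the operators \<open>Y[u,y]\<close>\<close>

lemma zero_of_additive:
  fixes f :: "'a::ab_group_add \<Rightarrow> 'b::ab_group_add"
  assumes "\<And>x y. f (x + y) = f x + f y"
  shows "f 0 = 0"
  using assms[of 0 0] by simp

lemma truncation_of_nat:
  fixes H :: "rat \<Rightarrow> 'a \<Rightarrow> 'b::zero"
  assumes "\<exists>N. \<forall>q<N. H q w = 0"
  shows "\<exists>B::nat. \<forall>i\<ge>B. H (c - of_nat i) w = 0"
proof -
  obtain N where N: "\<And>q. q < N \<Longrightarrow> H q w = 0" using assms by blast
  obtain B :: nat where B: "c - N < of_nat B" using reals_Archimedean2 by blast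
  show ?thesis
  proof (intro exI allI impI)
    fix i assume "B \<le> i"
    then have "rat_of_nat B \<le> of_nat i" by simp
    with B show "H (c - of_nat i) w = 0" by (intro N) linarith
  qed
qed

section \<open>Additivity of the left-hand side in each operator\<close>

context complex_vector_space
begin

text \<open>The exponent of x_0 leaves at most one n, and truncation bounds i.\<close>

lemma finite_jacobi_term:
  fixes a :: rat and P :: "int \<Rightarrow> nat \<Rightarrow> 'a"
  assumes "\<And>n i. i \<ge> B \<Longrightarrow> P n i = 0"
  shows "finite {x. (case x of (n, i) \<Rightarrow> scale (k (n, i)) (if a + 1 + of_int n = 0 then P n i else 0)) \<noteq> 0}"
proof (rule finite_subset)
  show "{x. (case x of (n, i) \<Rightarrow> scale (k (n, i)) (if a + 1 + of_int n = 0 then P n i else 0)) \<noteq> 0}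
    \<subseteq> {\<lfloor>- a - 1\<rfloor>} \<times> {..<B}"
  proof safe
    fix n i assume "scale (k (n, i)) (if a + 1 + of_int n = 0 then P n i else 0) \<noteq> 0"
    then have "of_int n = - a - 1" "P n i \<noteq> 0" by (auto split: if_splits)
    then show "n = \<lfloor>- a - 1\<rfloor>" "i < B"
      using assms[of i n] by (metis floor_of_int, metis not_less)
  qed
qed simp

lemma jacobi_term_add:
  fixes a :: rat and P :: "int \<Rightarrow> nat \<Rightarrow> 'a"
  assumes P: "\<And>n i. i \<ge> B \<Longrightarrow> P n i = 0" and P': "\<And>n i. i \<ge> B \<Longrightarrow> P' n i = 0"
  shows "Sum_any (\<lambda>(n, i). scale (k (n, i)) (if a + 1 + of_int n = 0 then P n i + P' n i else 0)) =
    Sum_any (\<lambda>(n, i). scale (k (n, i)) (if a + 1 + of_int n = 0 then P n i else 0)) +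
    Sum_any (\<lambda>(n, i). scale (k (n, i)) (if a + 1 + of_int n = 0 then P' n i else 0))"
proof -
  let ?t = "\<lambda>P (n, i). scale (k (n, i)) (if a + 1 + rat_of_int n = 0 then P n i else 0)"
  have "?t (\<lambda>n i. P n i + P' n i) = (\<lambda>x. ?t P x + ?t P' x)"
    by (auto simp: fun_eq_iff scale_right_distrib)
  then show ?thesis
    using Sum_any.distrib[OF finite_jacobi_term[of B P, OF P] finite_jacobi_term[of B P', OF P'], of k a k a]
    by simp
qed

lemma jacobi_lhs_add_left:
  assumes H: "\<And>q x y. H q (x + y) = H q x + H q y"
    and F0: "\<And>q. F q 0 = 0" "\<And>q. F' q 0 = 0"
    and tr: "\<And>x. \<exists>N. \<forall>q<N. F q x = 0" "\<And>x. \<exists>N. \<forall>q<N. F' q x = 0" "\<And>x. \<exists>N. \<forall>q<N. H q x = 0"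
  shows "jacobi_lhs scale (\<lambda>q x. F q x + F' q x) H w e = jacobi_lhs scale F H w e + jacobi_lhs scale F' H w e"
proof -
  obtain a b c where e: "e = (a, b, c)" by (cases e)
  obtain B where B: "\<And>i. i \<ge> B \<Longrightarrow> H (c - of_nat i) w = 0"
    using truncation_of_nat[where H=H and w=w and c=c, OF tr(3)] by blast
  obtain B1 where B1: "\<And>i. i \<ge> B1 \<Longrightarrow> F (b - of_nat i) w = 0"
    using truncation_of_nat[where H=F and w=w and c=b, OF tr(1)] by blast
  obtain B2 where B2: "\<And>i. i \<ge> B2 \<Longrightarrow> F' (b - of_nat i) w = 0"
    using truncation_of_nat[where H=F' and w=w and c=b, OF tr(2)] by blast
  have H0: "H q 0 = 0" for q using H by (rule zero_of_additive)
  have 1: "Sum_any (\<lambda>(n, i). scale (delta_coeff 1 1 (-1) (n, i))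
      (if a + 1 + of_int n = 0 then F (b - of_int n + of_nat i) (H (c - of_nat i) w) + F' (b - of_int n + of_nat i) (H (c - of_nat i) w) else 0))
    = Sum_any (\<lambda>(n, i). scale (delta_coeff 1 1 (-1) (n, i))
      (if a + 1 + of_int n = 0 then F (b - of_int n + of_nat i) (H (c - of_nat i) w) else 0))
    + Sum_any (\<lambda>(n, i). scale (delta_coeff 1 1 (-1) (n, i))
      (if a + 1 + of_int n = 0 then F' (b - of_int n + of_nat i) (H (c - of_nat i) w) else 0))"
    by (rule jacobi_term_add[where B=B]) (simp_all add: B F0)
  have 2: "Sum_any (\<lambda>(n, i). scale (delta_coeff (-1) 1 (-1) (n, i))
      (if a + 1 + of_int n = 0 then H (c - of_int n + of_nat i) (F (b - of_nat i) w + F' (b - of_nat i) w) else 0))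
    = Sum_any (\<lambda>(n, i). scale (delta_coeff (-1) 1 (-1) (n, i))
      (if a + 1 + of_int n = 0 then H (c - of_int n + of_nat i) (F (b - of_nat i) w) else 0))
    + Sum_any (\<lambda>(n, i). scale (delta_coeff (-1) 1 (-1) (n, i))
      (if a + 1 + of_int n = 0 then H (c - of_int n + of_nat i) (F' (b - of_nat i) w) else 0))"
    unfolding H 
    \<comment> \<open>Here the inner operators are F and F', each with its own truncation, and the
      outer H maps their vanishing values to 0.\<close>
    by (rule jacobi_term_add[where B="max B1 B2"]) (simp_all add: B1 B2 H0)
  show ?thesis unfolding e jacobi_lhs_eq 1 2 by (simp only: algebra_simps)
qed

lemma jacobi_lhs_add_right:
  assumes F: "\<And>q x y. F q (x + y) = F q x + F q y"
    and H0: "\<And>q. H q 0 = 0" "\<And>q. H' q 0 = 0"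
    and tr: "\<And>x. \<exists>N. \<forall>q<N. H q x = 0" "\<And>x. \<exists>N. \<forall>q<N. H' q x = 0" "\<And>x. \<exists>N. \<forall>q<N. F q x = 0"
  shows "jacobi_lhs scale F (\<lambda>q x. H q x + H' q x) w e = jacobi_lhs scale F H w e + jacobi_lhs scale F H' w e"
proof -
  obtain a b c where e: "e = (a, b, c)" by (cases e)
  obtain B where B: "\<And>i. i \<ge> B \<Longrightarrow> F (b - of_nat i) w = 0"
    using truncation_of_nat[where H=F and w=w and c=b, OF tr(3)] by blast
  obtain B1 where B1: "\<And>i. i \<ge> B1 \<Longrightarrow> H (c - of_nat i) w = 0"
    using truncation_of_nat[where H=H and w=w and c=c, OF tr(1)] by blast
  obtain B2 where B2: "\<And>i. i \<ge> B2 \<Longrightarrow> H' (c - of_nat i) w = 0"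
    using truncation_of_nat[where H=H' and w=w and c=c, OF tr(2)] by blast
  have F0: "F q 0 = 0" for q using F by (rule zero_of_additive)
  have 1: "Sum_any (\<lambda>(n, i). scale (delta_coeff 1 1 (-1) (n, i))
      (if a + 1 + of_int n = 0 then F (b - of_int n + of_nat i) (H (c - of_nat i) w + H' (c - of_nat i) w) else 0))
    = Sum_any (\<lambda>(n, i). scale (delta_coeff 1 1 (-1) (n, i))
      (if a + 1 + of_int n = 0 then F (b - of_int n + of_nat i) (H (c - of_nat i) w) else 0))
    + Sum_any (\<lambda>(n, i). scale (delta_coeff 1 1 (-1) (n, i))
      (if a + 1 + of_int n = 0 then F (b - of_int n + of_nat i) (H' (c - of_nat i) w) else 0))"
    unfolding F 
    by (rule jacobi_term_add[where B="max B1 B2"]) (simp_all add: B1 B2 F0)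
  have 2: "Sum_any (\<lambda>(n, i). scale (delta_coeff (-1) 1 (-1) (n, i))
      (if a + 1 + of_int n = 0 then H (c - of_int n + of_nat i) (F (b - of_nat i) w) + H' (c - of_int n + of_nat i) (F (b - of_nat i) w) else 0))
    = Sum_any (\<lambda>(n, i). scale (delta_coeff (-1) 1 (-1) (n, i))
      (if a + 1 + of_int n = 0 then H (c - of_int n + of_nat i) (F (b - of_nat i) w) else 0))
    + Sum_any (\<lambda>(n, i). scale (delta_coeff (-1) 1 (-1) (n, i))
      (if a + 1 + of_int n = 0 then H' (c - of_int n + of_nat i) (F (b - of_nat i) w) else 0))"
    by (rule jacobi_term_add[where B=B]) (simp_all add: B H0)
  show ?thesis unfolding e jacobi_lhs_eq 1 2 by (simp only: algebra_simps)
qed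

end

lemma fls_X_power_const_times_nth:
  fixes g :: "'a::field fls"
  shows "fls_nth (fls_X ^ j * fls_const k * g) m = k * fls_nth g (m - int j)"
proof -
  have "fls_X ^ j * fls_const k * g = fls_X ^ j * (fls_const k * g)" by (simp only: mult.assoc)
  then show ?thesis by (simp add: fls_X_power_times_conv_shift)
qed

section \<open>Homogeneous operators and the coefficients of \<open>Y[u,y]v\<close>\<close>

context vertex_operator_algebra
begin

lemma hom_vertex_series_add:
  fixes F :: "'v \<Rightarrow> rat \<Rightarrow> 'm \<Rightarrow> 'm::ab_group_add"
  assumes F: "\<And>v v' n. F (v + v') n w = F v n w + F v' n w"
  shows "hom_vertex_series G F (v + v') q w = hom_vertex_series G F v q w + hom_vertex_series G F v' q w"
proof -
  have F0: "F 0 n w = 0" for n using F by (rule zero_of_additive)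
  have fin: "finite {k. vertex_series F (graded_component G v k) (q - of_int k) w \<noteq> 0}" for v
    by (rule finite_subset[OF _ finite_graded_component[of v]]) (auto simp: vertex_series_def F0)
  show ?thesis
    unfolding hom_vertex_series_def graded_component_add
    using fin[of v] fin[of v'] by (subst Sum_any.distrib[symmetric]) (simp_all add: vertex_series_def F)
qed

lemma hom_vertex_series_homogeneous:
  fixes F :: "'v \<Rightarrow> rat \<Rightarrow> 'm \<Rightarrow> 'm::ab_group_add"
  assumes "v \<in> G k" and F0: "\<And>n. F 0 n w = 0"
  shows "hom_vertex_series G F v q w = vertex_series F v (q - of_int k) w"
proof -
  have "vertex_series F (graded_component G v i) (q - of_int i) w =
     (if i = k then vertex_series F v (q - of_int i) w else 0)" for i
    using assms by (simp add: graded_component_homogeneous vertex_series_def)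
  then show ?thesis by (simp add: hom_vertex_series_def)
qed

lemma Y_add_left: "Y (u + u') n v = Y u n v + Y u' n v"
  and Y_scale_left: "Y (scale a u) n v = scale a (Y u n v)"
proof -
  interpret Vector_Spaces.linear scale scale "\<lambda>u. Y u n v" by (rule linear_left)
  show "Y (u + u') n v = Y u n v + Y u' n v" "Y (scale a u) n v = scale a (Y u n v)"
    by (rule add scale)+
qed

lemma Y_add_right: "Y u n (v + v') = Y u n v + Y u n v'"
  and Y_scale_right: "Y u n (scale a v) = scale a (Y u n v)"
  and Y_zero_right: "Y u n 0 = 0"
proof -
  interpret Vector_Spaces.linear scale scale "Y u n" by (rule linear_mode)
  show "Y u n (v + v') = Y u n v + Y u n v'" "Y u n (scale a v) = scale a (Y u n v)" "Y u n 0 = 0"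
    by (rule add scale zero)+
qed

abbreviation L0 :: "'v \<Rightarrow> 'v" where "L0 \<equiv> Lop Y \<omega> 0"

lemma L0_power_add: "(L0 ^^ j) (u + u') = (L0 ^^ j) u + (L0 ^^ j) u'"
  by (induction j) (simp_all add: Lop_def Y_add_right)

lemma L0_power_homogeneous: "u \<in> G h \<Longrightarrow> (L0 ^^ j) u = scale (of_int h ^ j) u"
proof (induction j)
  case (Suc j)
  then show ?case using L0_grading[OF Suc.prems] by (simp add: Lop_def Y_scale_right mult.commute)
qed simp

lemma mem_grade_of_L0:
  assumes "L0 v = scale (of_int k) v"
  shows "v \<in> G k"
proof (rule mem_grade_of_eigenvector[where f=L0 and t=of_int, OF _ L0_grading _ assms])
  show "Vector_Spaces.linear scale scale L0" unfolding Lop_def by (rule linear_mode)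
  show "inj (of_int :: int \<Rightarrow> complex)" by (simp add: inj_on_def)
qed

lemma truncation_int: "\<exists>N. \<forall>n\<ge>N. Y u (of_int n) v = 0"
proof -
  obtain N where N: "\<And>n. n \<ge> N \<Longrightarrow> Y u n v = 0" using truncation by blast
  have "\<forall>n\<ge>\<lceil>N\<rceil>. Y u (of_int n) v = 0" by (auto intro!: N simp: ceiling_le_iff)
  then show ?thesis by blast
qed

text \<open>On a homogeneous vector the powers of \<open>L0\<close> act by scalars, so one bound
  serves all j; for sums take the maximum. This uniformity makes the double sum in
  \<open>bracket_series\<close> finite.\<close>

lemma uniform_truncation: "\<exists>N. \<forall>j. \<forall>n\<ge>N. Y ((L0 ^^ j) u) (of_int n) v = 0"
proof (induction u rule: graded_induct)
  case (homogeneous h u)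
  obtain N where "\<forall>n\<ge>N. Y u (of_int n) v = 0" using truncation_int by blast
  then show ?case using homogeneous by (intro exI[of _ N]) (simp add: L0_power_homogeneous Y_scale_left)
next
  case (add u u')
  then obtain N N' where "\<forall>j. \<forall>n\<ge>N. Y ((L0 ^^ j) u) (of_int n) v = 0"
    "\<forall>j. \<forall>n\<ge>N'. Y ((L0 ^^ j) u') (of_int n) v = 0" by blast
  then show ?case by (intro exI[of _ "max N N'"]) (simp add: L0_power_add Y_add_left)
qed

definition bracket_term :: "'v \<Rightarrow> 'v \<Rightarrow> int \<Rightarrow> nat \<times> int \<Rightarrow> 'v" where
  "bracket_term u v m = (\<lambda>(j, n).
     scale (1 / fact j * fls_nth (fps_to_fls (fps_exp 1 - 1) powi (- n - 1)) (m - int j))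
       (Y ((L0 ^^ j) u) (of_int n) v))"

lemma bracket_series_eq: "bracket_series scale Y \<omega> u v m = Sum_any (bracket_term u v m)"
  unfolding bracket_series_def bracket_term_def fls_X_power_const_times_nth ..

text \<open>(e^y - 1)^(-n-1) has order -n-1, so a nonzero coefficient at m - j requires m - j >=
  -n-1.\<close>

lemma bracket_term_support:
  assumes "\<And>j n. n \<ge> N \<Longrightarrow> Y ((L0 ^^ j) u) (of_int n) v = 0" and "bracket_term u v m (j, n) \<noteq> 0"
  shows "int j \<le> m + n + 1" "n < N"
proof -
  have "fls_nth (fps_to_fls (fps_exp (1::complex) - 1) powi (- n - 1)) (m - int j) \<noteq> 0"
    "Y ((L0 ^^ j) u) (of_int n) v \<noteq> 0"
    using assms(2) by (auto simp: bracket_term_def)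
  then show "int j \<le> m + n + 1" "n < N"
    using fls_exp_minus_1_powi_nth_eq_0[of "m - int j" "- n - 1", where 'a=complex] assms(1)[of n j]
    by (force simp: not_less[symmetric])+
qed

lemma finite_bracket_term: "finite {x. bracket_term u v m x \<noteq> 0}"
proof -
  obtain N where N: "\<And>j n. n \<ge> N \<Longrightarrow> Y ((L0 ^^ j) u) (of_int n) v = 0"
    using uniform_truncation by blast
  have "{x. bracket_term u v m x \<noteq> 0} \<subseteq> {..nat (m + N + 1)} \<times> {- m - 1..N}"
    using bracket_term_support[OF N] by fastforce
  then show ?thesis by (rule finite_subset) simp
qed

lemma bracket_series_truncation: "\<exists>M. \<forall>m<M. bracket_series scale Y \<omega> u v m = 0"
proof -
  obtain N where N: "\<And>j n. n \<ge> N \<Longrightarrow> Y ((L0 ^^ j) u) (of_int n) v = 0"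
    using uniform_truncation by blast
  \<comment> \<open>A nonzero term would have 0 <= j <= m + n + 1 and n < N, hence m >= -N.\<close>
  have "bracket_term u v m x = 0" if "m < - N" for m x
    using bracket_term_support[OF N, where j="fst x" and n="snd x" and m=m] that by fastforce
  then show ?thesis by (intro exI[of _ "- N"]) (simp add: bracket_series_eq)
qed

lemma bracket_series_add_left:
  "bracket_series scale Y \<omega> (u + u') v m = bracket_series scale Y \<omega> u v m + bracket_series scale Y \<omega> u' v m"
proof -
  have "bracket_term (u + u') v m = (\<lambda>x. bracket_term u v m x + bracket_term u' v m x)"
    by (auto simp: fun_eq_iff bracket_term_def L0_power_add Y_add_left scale_right_distrib)
  then show ?thesis by (simp add: bracket_series_eq Sum_any.distrib finite_bracket_term)
qed

lemma bracket_series_add_right: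
  "bracket_series scale Y \<omega> u (v + v') m = bracket_series scale Y \<omega> u v m + bracket_series scale Y \<omega> u v' m"
proof -
  have "bracket_term u (v + v') m = (\<lambda>x. bracket_term u v m x + bracket_term u v' m x)"
    by (auto simp: fun_eq_iff bracket_term_def Y_add_right scale_right_distrib)
  then show ?thesis by (simp add: bracket_series_eq Sum_any.distrib finite_bracket_term)
qed

text \<open>Since L(0) acts on u as h, the sum over j of y^j h^j / j! is e^(hy). The range of n
  depends on the bound M instead of m, so that a single finite index set serves all m <= M, as
  \<open>exp_log_subst_exp_powi\<close> requires.\<close>

lemma bracket_series_homogeneous:
  assumes u: "u \<in> G h" and N: "\<And>n. n \<ge> N \<Longrightarrow> Y u (of_int n) v = 0" and m: "m \<le> M"
  shows "bracket_series scale Y \<omega> u v m =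
    (\<Sum>n\<in>{- M - 1..<N}. scale (fls_nth (fps_to_fls (fps_exp (of_int h)) * fps_to_fls (fps_exp 1 - 1) powi (- n - 1)) m)
       (Y u (of_int n) v))"
proof -
  have N': "Y ((L0 ^^ j) u) (of_int n) v = 0" if "n \<ge> N" for j n
    using N[OF that] u by (simp add: L0_power_homogeneous Y_scale_left)
  let ?J = "{..nat (m + N + 1)}" and ?I = "{- M - 1..<N}"
  let ?f = "\<lambda>n j. fps_nth (fps_exp (of_int h)) j * fls_nth (fps_to_fls (fps_exp (1::complex) - 1) powi (- n - 1)) (m - int j)"
  have "{x. bracket_term u v m x \<noteq> 0} \<subseteq> ?J \<times> ?I"
    using bracket_term_support[OF N'] m by fastforce
  then have "bracket_series scale Y \<omega> u v m = (\<Sum>(j, n)\<in>?J \<times> ?I. bracket_term u v m (j, n))"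
    by (simp add: bracket_series_eq Sum_any.expand_superset case_prod_unfold)
  also have "\<dots> = (\<Sum>n\<in>?I. \<Sum>j\<in>?J. bracket_term u v m (j, n))"
    unfolding sum.cartesian_product[symmetric] by (rule sum.swap)
  also have "\<dots> = (\<Sum>n\<in>?I. \<Sum>j\<in>?J. scale (?f n j) (Y u (of_int n) v))"
    using u by (simp add: bracket_term_def L0_power_homogeneous Y_scale_left mult_ac)
  also have "\<dots> = (\<Sum>n\<in>?I. scale (Sum_any (?f n)) (Y u (of_int n) v))"
  proof (intro sum.cong refl)
    fix n assume n: "n \<in> ?I"
    have "{j. ?f n j \<noteq> 0} \<subseteq> ?J"
    proof
      fix j assume "j \<in> {j. ?f n j \<noteq> 0}"
      then have "\<not> m - int j < - n - 1"
        using fls_exp_minus_1_powi_nth_eq_0[of "m - int j" "- n - 1", where 'a=complex] by auto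
      with n show "j \<in> ?J" by auto
    qed
    then have "Sum_any (?f n) = (\<Sum>j\<in>?J. ?f n j)" by (intro Sum_any.expand_superset) auto
    then show "(\<Sum>j\<in>?J. scale (?f n j) (Y u (of_int n) v)) = scale (Sum_any (?f n)) (Y u (of_int n) v)"
      by (simp only: scale_sum_left)
  qed
  finally show ?thesis by (simp only: fps_to_fls_times_nth[of "fps_exp (of_int h)"])
qed

end

section \<open>The homogeneous Jacobi identity\<close>

context complex_vector_space
begin

text \<open>Multiplying the operators by x_1^s and x_2^t commutes with the delta functions and only
  moves exponents; s and t will be the weights of u and v.\<close>

lemma jacobi_lhs_shift:
  "jacobi_lhs scale (\<lambda>q. F (q - s)) (\<lambda>q. H (q - t)) w (a, b, c) = jacobi_lhs scale F H w (a, b - s, c - t)"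
proof -
  have "b - of_int n + of_nat i - s = b - s - of_int n + of_nat i"
    "c - of_int n + of_nat i - t = c - t - of_int n + of_nat i"
    "b - of_nat i - s = b - s - of_nat i" "c - of_nat i - t = c - t - of_nat i" for n :: int and i :: nat
    by simp_all
  then show ?thesis unfolding jacobi_lhs_eq by (simp only:)
qed

text \<open>The coefficient of x_0^(-1) uses only the zeroth powers of the binomials, and binom(0,
  i) = 0 for i > 0.\<close>

lemma jacobi_lhs_commutator:
  assumes "F b 0 = 0" "H c 0 = 0"
  shows "jacobi_lhs scale F H w (-1, b, c) = F b (H c w) - H c (F b w)"
proof -
  have gc: "(0::complex) gchoose i = (if i = 0 then 1 else 0)" for i by (cases i) simp_all
  have "Sum_any (\<lambda>(n, i). scale (delta_coeff s 1 (-1) (n, i)) (if - 1 + 1 + rat_of_int n = 0 then P n i else 0))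
    = P 0 0" for s P
    by (subst Sum_any_graph[of "\<lambda>_. 0"])
       (auto simp: delta_coeff_def gc if_distrib[of "\<lambda>x. scale (x * _) _"] if_distrib[of "\<lambda>x. scale x _"] cong: if_cong)
  then show ?thesis unfolding jacobi_lhs_eq by simp
qed

end

context vertex_operator_algebra
begin

text \<open>
  This is \<open>[L(0), Y(u,x)] = x Y(L(-1)u,x) + Y(L(0)u,x)\<close>, the coefficient of
  \<open>x\<^sub>0\<^bsup>-1\<^esup> x\<^sub>1\<^bsup>-2\<^esup>\<close> in the Jacobi identity for \<open>\<omega>\<close> and \<open>u\<close>.
\<close>

lemma Y_mem_grade:
  assumes u: "u \<in> G h" and v: "v \<in> G l"
  shows "Y u (of_int n) v \<in> G (h + l - n - 1)"
proof (rule mem_grade_of_L0)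
  \<comment> \<open>The exponent -2 of x_1 belongs to the mode \<omega>_1 = L(0) and the exponent
    \<open>?c\<close> of x_2 to u_n; \<open>?c + 1\<close> below absorbs the factor x_2^(-1) of the
    Jacobi identity.\<close>
  let ?c = "- of_int n - 1 :: rat"
  let ?t = "\<lambda>x. scale (delta_coeff 1 1 (-1) x) (iterate_series Y Y \<omega> u v ((-1, -2, ?c + 1) - delta_expo 1 (0, 1, -1) (1, 0, -1) x))"
  have "L0 (Y u (of_int n) v) - Y u (of_int n) (L0 v) = jacobi_lhs scale (vertex_series Y \<omega>) (vertex_series Y u) v (-1, -2, ?c)"
    by (subst jacobi_lhs_commutator) (simp_all add: vertex_series_def Y_zero_right Lop_def)
  also have "\<dots> = Sum_any ?t"
    by (simp add: jacobi fmult_mult_monomial fmult_shift fmult_delta_binomial inj_delta_expo)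
  \<comment> \<open>The exponent -2 of x_1 equals n - i.\<close>
  also have "\<dots> = Sum_any (\<lambda>i. ?t (int i - 2, i))"
    by (rule Sum_any_graph) (auto simp: iterate_series_def delta_expo_eq)
  also have "\<dots> = (\<Sum>i\<in>{0,1}. ?t (int i - 2, i))"
  proof (rule Sum_any.expand_superset)
    show "{i. ?t (int i - 2, i) \<noteq> 0} \<subseteq> {0, 1}"
    proof (rule subsetI, rule ccontr)
      fix i assume i: "i \<in> {i. ?t (int i - 2, i) \<noteq> 0}" "i \<notin> {0, 1}"
      then have "i \<ge> 2" by auto
      \<comment> \<open>For i >= 2 the power i - 2 is a natural number smaller than i, so its
        binomial coefficient vanishes.\<close>
      then have "(of_int (int i - 2) :: complex) = of_nat (i - 2)" by (simp add: of_nat_diff)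
      moreover have "i - 2 < i" using \<open>i \<ge> 2\<close> by simp
      ultimately have "delta_coeff 1 1 (-1) (int i - 2, i) = 0"
        by (simp add: delta_coeff_def binomial_gbinomial[symmetric] del: of_int_diff)
      with i show False by simp
    qed
  qed simp
  \<comment> \<open>The term i = 0 contains \<omega>_0 = L(-1) and i = 1 contains \<omega>_1 = L(0);
    the coefficients binom(-2, 0) and -binom(-1, 1) are both 1.\<close>
  also have "\<dots> = vertex_series Y (Lop Y \<omega> (-1) u) (?c - 1) v + Y (L0 u) (of_int n) v"
    by (simp add: delta_coeff_def iterate_series_def delta_expo_eq vertex_series_def Lop_def)
  also have "\<dots> = scale (of_int (- n - 1)) (Y u (of_int n) v) + scale (of_int h) (Y u (of_int n) v)"
    unfolding L_minus1_derivative using u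
    by (simp add: vertex_series_def L0_grading Y_scale_left of_rat_diff of_rat_minus)
  finally have "L0 (Y u (of_int n) v) - scale (of_int l) (Y u (of_int n) v) = \<dots>"
    using v by (simp add: L0_grading Y_scale_right)
  then show "L0 (Y u (of_int n) v) = scale (of_int (h + l - n - 1)) (Y u (of_int n) v)"
    by (simp add: algebra_simps scale_left_distrib scale_left_diff_distrib)
qed

end

context voa_automorphism
begin

text \<open>Because \<nu> fixes \<omega>, it commutes with the mode \<omega>_1 = L(0) and preserves
  its eigenspaces, which are the graded pieces.\<close>

lemma \<nu>_power_mem_grade: "u \<in> G h \<Longrightarrow> (\<nu> ^^ r) u \<in> G h"
proof (induction r)
  case (Suc r)
  interpret \<nu>: Vector_Spaces.linear scale scale \<nu> by (rule linear)
  have "L0 (\<nu> x) = \<nu> (L0 x)" for x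
    using fun_cong[OF conjugation[of \<omega> 1], of "\<nu> x"] bij
    by (simp add: preserves_conformal Lop_def bij_is_inj)
  then show ?case using Suc
    by (intro mem_grade_of_L0) (simp add: L0_grading \<nu>.scale)
qed simp

lemma \<nu>_power_add: "(\<nu> ^^ r) (u + u') = (\<nu> ^^ r) u + (\<nu> ^^ r) u'"
proof (induction r)
  case (Suc r)
  interpret \<nu>: Vector_Spaces.linear scale scale \<nu> by (rule linear)
  show ?case using Suc by (simp add: \<nu>.add)
qed simp

end

lemma power_int_add_mult_period:
  fixes \<alpha> :: complex
  assumes "\<alpha> ^ p = 1" "p > 0"
  shows "\<alpha> powi (k + int p * z) = \<alpha> powi k"
proof -
  have "\<alpha> \<noteq> 0" using assms by (auto simp: power_0_left)
  then show ?thesis using assms(1) by (simp add: power_int_add power_int_mult)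
qed

section \<open>The operators X_M on the twisted module\<close>

context twisted_module
begin

lemma YM_add_left: "YM (u + u') n w = YM u n w + YM u' n w"
  and YM_scale_left: "YM (scaleV a u) n w = scaleM a (YM u n w)"
  and YM_zero_left: "YM 0 n w = 0"
proof -
  interpret Vector_Spaces.linear scaleV scaleM "\<lambda>u. YM u n w" by (rule linear_left)
  show "YM (u + u') n w = YM u n w + YM u' n w" "YM (scaleV a u) n w = scaleM a (YM u n w)" "YM 0 n w = 0"
    by (rule add scale zero)+
qed

lemma YM_add_right: "YM u n (w + w') = YM u n w + YM u n w'"
proof -
  interpret Vector_Spaces.linear scaleM scaleM "YM u n" by (rule linear_mode)
  show "YM u n (w + w') = YM u n w + YM u n w'"
    by (rule add)
qed

abbreviation XM :: "'v \<Rightarrow> rat \<Rightarrow> 'm \<Rightarrow> 'm" where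
  "XM \<equiv> hom_vertex_series GV YM"

lemma XM_add_left: "XM (v + v') q w = XM v q w + XM v' q w"
  by (rule V.hom_vertex_series_add) (rule YM_add_left)

lemma XM_zero_left: "XM 0 q w = 0"
  using XM_add_left by (rule zero_of_additive)

lemma XM_homogeneous: "v \<in> GV k \<Longrightarrow> XM v q w = vertex_series YM v (q - of_int k) w"
  by (rule V.hom_vertex_series_homogeneous) (auto simp: YM_zero_left)

lemma XM_scale_left: "XM (scaleV a v) q w = scaleM a (XM v q w)"
proof (induction v rule: V.graded_induct)
  case (homogeneous k v)
  then have "scaleV a v \<in> GV k" using V.subspace_G V.subspace_scale by blast
  with homogeneous show ?case by (simp add: XM_homogeneous vertex_series_def YM_scale_left)
qed (simp add: V.scale_right_distrib scale_right_distrib XM_add_left)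

lemma XM_sum_left: "XM (\<Sum>n\<in>I. scaleV (f n) (x n)) q w = (\<Sum>n\<in>I. scaleM (f n) (XM (x n) q w))"
proof (induction I rule: infinite_finite_induct)
  case (insert n I)
  then show ?case by (simp add: XM_add_left XM_scale_left)
qed (simp_all add: XM_zero_left)

lemma XM_add_right: "XM v q (w + w') = XM v q w + XM v q w'"
  by (induction v rule: V.graded_induct)
     (simp_all add: XM_homogeneous vertex_series_def YM_add_right XM_add_left)

lemma XM_zero_right: "XM v q 0 = 0"
  using XM_add_right by (rule zero_of_additive)

lemma XM_truncation: "\<exists>N. \<forall>q<N. XM v q w = 0"
proof (induction v rule: V.graded_induct)
  case (homogeneous k v)
  obtain N where N: "\<And>n. n \<ge> N \<Longrightarrow> YM v n w = 0" using truncation by blast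
  show ?case
    by (rule exI[of _ "of_int k - 1 - N"]) (auto simp: XM_homogeneous[OF homogeneous] vertex_series_def intro!: N)
next
  case (add v v')
  then obtain N N' where "\<forall>q<N. XM v q w = 0" "\<forall>q<N'. XM v' q w = 0" by blast
  then show ?case by (intro exI[of _ "min N N'"]) (simp add: XM_add_left)
qed

lemma hom_iterate_series_eq:
  "hom_iterate_series scaleV GV Y \<omega> YM u v w =
     integral_series (\<lambda>m c. XM (bracket_series scaleV Y \<omega> u v m) c w)"
  by (simp add: hom_iterate_series_def integral_series_def)

text \<open>For \<alpha> = \<zeta>^(-r) and \<nu>^r u in place of u, this is the r-th summand on the
  right of the identity.\<close>

definition iterate_term :: "complex \<Rightarrow> 'v \<Rightarrow> 'v \<Rightarrow> 'm \<Rightarrow> 'm fseries" where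
  "iterate_term \<alpha> u v w = exp_log_subst scaleM \<alpha> p (\<lambda>m c. XM (bracket_series scaleV Y \<omega> u v m) c w)"

lemma iterate_term_add:
  assumes "p > 0"
  shows "iterate_term \<alpha> (u + u') v w e = iterate_term \<alpha> u v w e + iterate_term \<alpha> u' v w e"
    and "iterate_term \<alpha> u (v + v') w e = iterate_term \<alpha> u v w e + iterate_term \<alpha> u v' w e"
proof -
  have lower: "\<exists>M. \<forall>m<M. \<forall>c. XM (bracket_series scaleV Y \<omega> u v m) c w = 0" for u v
    using V.bracket_series_truncation[of u v] by (metis XM_zero_left)
  obtain M where M: "\<And>m c. m < M \<Longrightarrow> XM (bracket_series scaleV Y \<omega> u v m) c w = 0"
    using lower by blast
  obtain M1 where M1: "\<And>m c. m < M1 \<Longrightarrow> XM (bracket_series scaleV Y \<omega> u' v m) c w = 0"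
    using lower by blast
  obtain M2 where M2: "\<And>m c. m < M2 \<Longrightarrow> XM (bracket_series scaleV Y \<omega> u v' m) c w = 0"
    using lower by blast
  show "iterate_term \<alpha> (u + u') v w e = iterate_term \<alpha> u v w e + iterate_term \<alpha> u' v w e"
    unfolding iterate_term_def V.bracket_series_add_left XM_add_left
    by (rule exp_log_subst_add[OF assms M M1])
  show "iterate_term \<alpha> u (v + v') w e = iterate_term \<alpha> u v w e + iterate_term \<alpha> u v' w e"
    unfolding iterate_term_def V.bracket_series_add_right XM_add_left
    by (rule exp_log_subst_add[OF assms M M2])
qed

text \<open>
  Both sides equal, up to the factor \<open>\<alpha>\<^bsup>pb\<^esup>\<close>, the sum over \<open>n\<close> of
  \<open>binom(h - b - 1, a + n + 1)\<close> times a mode of \<open>u\<^sub>n v\<close>, and vanish unless \<open>a\<close> and \<open>p b\<close> are integers.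
\<close>

lemma twisted_iterate_homogeneous:
  assumes p: "p > 0" and \<alpha>: "\<alpha> ^ p = 1" and u: "u \<in> GV h" and v: "v \<in> GV l"
  shows "fmult scaleM (delta_binomial \<alpha> p (0, 1, -1) (1, 0, -1) (-1)) (iterate_series Y YM u v w)
      (a, b - of_int h, d - of_int l + 1) =
    iterate_term (inverse \<alpha>) u v w (a, b + 1, d)" (is "?L = ?R")
proof -
  \<comment> \<open>The \<open>+ 1\<close> in the last coordinate and the \<open>b + 1\<close> on
    the other side account for the factors x_2^(-1) and x_1^(-1) in front of the two right-hand
    sides.\<close>
  let ?e = "(a, b - of_int h, d - of_int l + 1)"
  let ?t = "\<lambda>x. scaleM (delta_coeff \<alpha> p (-1) x)
    (iterate_series Y YM u v w (?e - delta_expo p (0, 1, -1) (1, 0, -1) x))"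
  have t: "?t (n, i) = scaleM (delta_coeff \<alpha> p (-1) (n, i))
      (if b - of_int h - (of_int n / of_nat p - of_nat i) = 0
       then vertex_series YM (vertex_series Y u (a - of_nat i) v) (d - of_int l + 1 + of_int n / of_nat p) w else 0)" for n i
    by (simp add: delta_expo_eq iterate_series_def algebra_simps)
  \<comment> \<open>The exponent of x_1 forces n = p (b + i - h), an integer exactly when pb is
    one.\<close>
  have iff: "b - of_int h - (of_int n / of_nat p - of_nat i) = 0 \<longleftrightarrow>
      of_int n = of_nat p * b + of_int (int p * (int i - h))" for n i
    using p by (auto simp: field_simps)
  have L: "?L = Sum_any ?t"
    by (rule fmult_delta_binomial[OF inj_delta_expo(3)[OF p]])
  show ?thesis
  proof (cases "a \<in> \<int> \<and> of_nat p * b \<in> \<int>")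
    case False
    have "?t x = 0" for x
    proof (cases "a \<in> \<int>")
      case False
      have "- (a - of_nat i) - 1 \<notin> \<int>" for i
      proof
        assume "- (a - of_nat i) - 1 \<in> \<int>"
        then have "of_nat i - 1 - (- (a - of_nat i) - 1) \<in> \<int>" by (intro Ints_diff) auto
        with False show False by simp
      qed
      then have "vertex_series Y u (a - of_nat i) v = 0" for i
        unfolding vertex_series_def by (rule V.integral_modes)
      moreover have "vertex_series YM 0 q w = 0" for q by (simp add: vertex_series_def YM_zero_left)
      ultimately have "?t (fst x, snd x) = 0" unfolding t by simp
      then show ?thesis by (simp only: prod.collapse)
    next
      case True
      with False have nb: "of_nat p * b \<notin> \<int>" by simp
      have "b - of_int h - (of_int n / of_nat p - of_nat i) \<noteq> 0" for n i
      proof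
        assume "b - of_int h - (of_int n / of_nat p - of_nat i) = 0"
        then have "of_nat p * b = of_int (n - int p * (int i - h))" unfolding iff by simp
        with nb show False by (metis Ints_of_int)
      qed
      then have "?t (fst x, snd x) = 0" unfolding t by simp
      then show ?thesis by (simp only: prod.collapse)
    qed
    then have "?L = 0" unfolding L by (rule Sum_any_zero)
    moreover have "of_nat p * (b + 1) \<in> \<int> \<longleftrightarrow> of_nat p * b \<in> \<int>"
      by (simp add: distrib_left)
    ultimately show ?thesis using False unfolding iterate_term_def exp_log_subst_eq[OF p] by auto
  next
    case True
    then obtain A N where A: "a = of_int A" and N: "of_nat p * b = of_int N" by (auto elim!: Ints_cases)
    define \<phi> where "\<phi> i = N + int p * (int i - h)" for i
    obtain T where T: "\<And>n. n \<ge> T \<Longrightarrow> Y u (of_int n) v = 0" using V.truncation_int by blast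
    let ?I = "{- A - 1..<T}"
    let ?x = "\<lambda>n. XM (Y u (of_int n) v) (d + a + (b + 1)) w"
    let ?k = "\<lambda>i. \<alpha> powi N * ((of_int h - of_rat (b + 1)) gchoose i)"
    have \<phi>: "of_int (\<phi> i) / of_nat p = b - of_int h + of_nat i" for i
      using p N by (simp add: \<phi>_def field_simps)
    \<comment> \<open>Negating the upper index turns (-1)^i binom(b - h + i, i) into binom(h - b -
      1, i), and the period p of \<alpha> removes the multiple of p from the exponent.\<close>
    have coeff: "delta_coeff \<alpha> p (-1) (\<phi> i, i) = ?k i" for i
    proof -
      have "((of_int h - of_rat (b + 1)) gchoose i) = (-1) ^ i * ((of_rat (b - of_int h + of_nat i) :: complex) gchoose i)"
        by (subst gbinomial_negated_upper) (simp add: of_rat_add of_rat_diff algebra_simps)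
      moreover have "\<alpha> powi (\<phi> i) = \<alpha> powi N"
        unfolding \<phi>_def by (rule power_int_add_mult_period[OF \<alpha> p])
      ultimately show ?thesis by (simp add: delta_coeff_def \<phi>)
    qed
    \<comment> \<open>With n = i - A - 1 the vector u_n v has weight h + l - i + A; subtracting it
      from d + a + b + 1 gives exactly the exponent of x_2 on the left.\<close>
    have summand: "?t (\<phi> i, i) = scaleM (?k i) (?x (int i - A - 1))" for i
    proof -
      have "Y u (of_int (int i - A - 1)) v \<in> GV (h + l - (int i - A - 1) - 1)"
        by (rule V.Y_mem_grade[OF u v])
      then have "?x (int i - A - 1) = vertex_series YM (Y u (of_int (int i - A - 1)) v) (d - of_int l + 1 + of_int (\<phi> i) / of_nat p) w"
        by (subst XM_homogeneous, assumption) (simp add: \<phi> A algebra_simps)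
      then show ?thesis unfolding t unfolding coeff by (simp add: \<phi> A vertex_series_def)
    qed
    have "?L = Sum_any (\<lambda>i. ?t (\<phi> i, i))"
      unfolding L
    proof (rule Sum_any_graph)
      fix n i assume "n \<noteq> \<phi> i"
      then have "b - of_int h - (of_int n / of_nat p - of_nat i) \<noteq> 0"
        unfolding iff N \<phi>_def by (simp only: of_int_add[symmetric] of_int_eq_iff) simp
      then show "?t (n, i) = 0" unfolding t by simp
    qed
    also have "\<dots> = Sum_any (\<lambda>i. scaleM (?k i) (?x (int i - A - 1)))"
      unfolding summand ..
    also have "\<dots> = (\<Sum>i\<in>{..<nat (T + A + 1)}. scaleM (?k i) (?x (int i - A - 1)))"
    proof (rule Sum_any.expand_superset)
      have "Y u (of_int (int i - A - 1)) v = 0" if "i \<notin> {..<nat (T + A + 1)}" for i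
        using that by (intro T) auto
      then show "{i. scaleM (?k i) (?x (int i - A - 1)) \<noteq> 0} \<subseteq> {..<nat (T + A + 1)}"
        by (metis (mono_tags, lifting) XM_zero_left mem_Collect_eq scale_zero_right subsetI)
    qed simp
    \<comment> \<open>Under i = A + n + 1 the bound i >= 0 becomes n >= -A - 1, the lower end of
      \<open>?I\<close>.\<close>
    also have "\<dots> = (\<Sum>n\<in>?I. scaleM (?k (nat (A + n + 1))) (?x n))"
      by (rule sum.reindex_bij_witness[of _ "\<lambda>n. nat (A + n + 1)" "\<lambda>i. int i - A - 1"]) auto
    also have "\<dots> = (\<Sum>n\<in>?I. scaleM (inverse \<alpha> powi (- \<lfloor>of_nat p * (b + 1)\<rfloor>) *
       (if \<lfloor>a\<rfloor> + n + 1 < 0 then 0 else (of_int h - of_rat (b + 1)) gchoose nat (\<lfloor>a\<rfloor> + n + 1))) (?x n))"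
    proof (intro sum.cong refl)
      fix n assume "n \<in> ?I"
      moreover have "of_nat p * (b + 1) = of_int (N + int p * 1)" using N by (simp add: distrib_left)
      then have "\<lfloor>of_nat p * (b + 1)\<rfloor> = N + int p * 1" by (simp only: floor_of_int)
      \<comment> \<open>The two inversions cancel, and passing from b to b + 1 adds p to the
        exponent, which \<alpha>^p = 1 removes.\<close>
      then have "inverse \<alpha> powi (- \<lfloor>of_nat p * (b + 1)\<rfloor>) = \<alpha> powi N"
        by (simp only: power_int_minus power_int_inverse inverse_inverse_eq power_int_add_mult_period[OF \<alpha> p])
      ultimately show "scaleM (?k (nat (A + n + 1))) (?x n) = scaleM (inverse \<alpha> powi (- \<lfloor>of_nat p * (b + 1)\<rfloor>) *
       (if \<lfloor>a\<rfloor> + n + 1 < 0 then 0 else (of_int h - of_rat (b + 1)) gchoose nat (\<lfloor>a\<rfloor> + n + 1))) (?x n)"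
        by (simp add: A)
    qed
    also have "\<dots> = ?R"
      unfolding iterate_term_def
    proof (rule exp_log_subst_exp_powi[OF p, symmetric])
      show "of_nat p * (b + 1) \<in> \<int>" using True by (simp add: distrib_left)
      fix m assume "m \<le> \<lfloor>a\<rfloor>"
      then have "m \<le> A" by (simp add: A)
      then show "XM (bracket_series scaleV Y \<omega> u v m) (d + a + (b + 1)) w =
        (\<Sum>n\<in>?I. scaleM (fls_nth (fps_to_fls (fps_exp (of_int h)) * fps_to_fls (fps_exp 1 - 1) powi (- n - 1)) m) (?x n))"
        by (simp only: V.bracket_series_homogeneous[OF u T] XM_sum_left)
    qed (use True in auto)
    finally show ?thesis .
  qed
qed

text \<open>Additivity reduces to homogeneous u and v, where the twisted Jacobi identity is shifted
  by their weights h and l. As \<nu>^r u again has weight h, the same shift works for every r, and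
  the summands agree one by one with \<alpha> = \<zeta>^r.\<close>

lemma homogeneous_twisted_jacobi:
  assumes p: "p > 0" and \<zeta>: "\<zeta> ^ p = 1"
  shows "jacobi_lhs scaleM (XM u) (XM v) w =
    fmult scaleM (monomial (1 / of_nat p) (0, -1, 0))
      (\<lambda>e. \<Sum>r<p. iterate_term (\<zeta> powi (- int r)) ((\<nu> ^^ r) u) v w e)"
proof
  fix e :: expo
  obtain a b c where e: "e = (a, b, c)" by (cases e)
  have e': "e - (0, -1, 0) = (a, b + 1, c)" by (simp add: e)
  let ?J = "\<lambda>u v. jacobi_lhs scaleM (XM u) (XM v) w e"
  let ?R = "\<lambda>u v. scaleM (1 / of_nat p) (\<Sum>r<p. iterate_term (\<zeta> powi (- int r)) ((\<nu> ^^ r) u) v w (a, b + 1, c))"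
  have "?J u v = ?R u v"
  proof (induction u rule: V.graded_induct)
    case (homogeneous h u)
    note u = this
    show ?case
    proof (induction v rule: V.graded_induct)
      case (homogeneous l v)
      note v = this
      have X: "XM u = (\<lambda>q. vertex_series YM u (q - of_int h))" "XM v = (\<lambda>q. vertex_series YM v (q - of_int l))"
        using u v by (auto simp: fun_eq_iff XM_homogeneous)
      have "?J u v = jacobi_lhs scaleM (vertex_series YM u) (vertex_series YM v) w (a, b - of_int h, c - of_int l)"
        unfolding X e by (rule jacobi_lhs_shift)
      also have "\<dots> = scaleM (1 / of_nat p) (\<Sum>r<p. fmult scaleM (delta_binomial (\<zeta> ^ r) p (0, 1, -1) (1, 0, -1) (-1))
            (iterate_series Y YM ((\<nu> ^^ r) u) v w) (a, b - of_int h, c - of_int l + 1))"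
        unfolding twisted_jacobi fmult_monomial by simp
      also have "\<dots> = ?R u v"
      proof (intro arg_cong[of _ _ "scaleM _"] sum.cong refl)
        fix r
        have "(\<zeta> ^ r) ^ p = 1" by (metis \<zeta> power_mult mult.commute power_one)
        from twisted_iterate_homogeneous[OF p this V.\<nu>_power_mem_grade[OF u] v]
        show "fmult scaleM (delta_binomial (\<zeta> ^ r) p (0, 1, -1) (1, 0, -1) (-1))
            (iterate_series Y YM ((\<nu> ^^ r) u) v w) (a, b - of_int h, c - of_int l + 1) =
          iterate_term (\<zeta> powi (- int r)) ((\<nu> ^^ r) u) v w (a, b + 1, c)"
          by (simp add: power_int_minus)
      qed
      finally show ?case .
    next
      case (add v v')
      have "XM (v + v') = (\<lambda>q x. XM v q x + XM v' q x)" by (simp add: fun_eq_iff XM_add_left)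
      then have "?J u (v + v') = ?J u v + ?J u v'"
        using jacobi_lhs_add_right[of "XM u" "XM v" "XM v'"] by (simp add: XM_add_right XM_zero_right XM_truncation)
      with add show ?case
        by (simp add: iterate_term_add[OF p] sum.distrib scale_right_distrib)
    qed
  next
    case (add u u')
    have "XM (u + u') = (\<lambda>q x. XM u q x + XM u' q x)" by (simp add: fun_eq_iff XM_add_left)
    then have "?J (u + u') v = ?J u v + ?J u' v"
      using jacobi_lhs_add_left[of "XM v" "XM u" "XM u'"] by (simp add: XM_add_right XM_zero_right XM_truncation)
    with add show ?case
      by (simp add: V.\<nu>_power_add iterate_term_add[OF p] sum.distrib scale_right_distrib)
  qed
  then show "?J u v = fmult scaleM (monomial (1 / of_nat p) (0, -1, 0))
      (\<lambda>e. \<Sum>r<p. iterate_term (\<zeta> powi (- int r)) ((\<nu> ^^ r) u) v w e) e"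
    unfolding fmult_monomial e' .
qed

end

theorem theorem4p1:
  fixes scaleV :: "complex \<Rightarrow> 'v::ab_group_add \<Rightarrow> 'v"
    and GV :: "int \<Rightarrow> 'v set"
    and Y :: "'v \<Rightarrow> rat \<Rightarrow> 'v \<Rightarrow> 'v"
    and vac \<omega> :: 'v
    and c :: complex
    and \<nu> :: "'v \<Rightarrow> 'v"
    and p :: nat
    and \<zeta> :: complex
    and scaleM :: "complex \<Rightarrow> 'm::ab_group_add \<Rightarrow> 'm"
    and GM :: "rat \<Rightarrow> 'm set"
    and YM :: "'v \<Rightarrow> rat \<Rightarrow> 'm \<Rightarrow> 'm"
    and u v :: 'v
    and w :: 'm
  assumes "vertex_operator_algebra scaleV GV Y vac \<omega> c"
    and "voa_automorphism scaleV GV Y vac \<omega> c \<nu>"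
    and "p > 0" and "\<nu> ^^ p = id"
    and "\<zeta> ^ p = 1" and "\<forall>k. 0 < k \<and> k < p \<longrightarrow> \<zeta> ^ k \<noteq> 1"
    and "twisted_module scaleV GV Y vac \<omega> c \<nu> scaleM GM p \<zeta> YM"
  shows "jacobi_lhs scaleM (hom_vertex_series GV YM u) (hom_vertex_series GV YM v) w =
    fmult scaleM (monomial (1 / of_nat p) (0, -1, 0))
      (\<lambda>e. \<Sum>r<p.
        subst_log scaleM
          (fmult scaleM (delta_exp (\<zeta> powi (- int r)) p)
            (hom_iterate_series scaleV GV Y \<omega> YM ((\<nu> ^^ r) u) v w)) e)"
proof -
  interpret twisted_module scaleV GV Y vac \<omega> c \<nu> scaleM GM p \<zeta> YM by fact
  show ?thesis
    using homogeneous_twisted_jacobi[OF \<open>p > 0\<close> \<open>\<zeta> ^ p = 1\<close>]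
    by (simp only: hom_iterate_series_eq iterate_term_def exp_log_subst_def)
qed

end
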